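(* Let $h>0$, let $w$ and $v$ be a weight function and a velocity function as in the context, $f(\rho)=\rho v(\rho)$ with stagnation point $\hat\rho$, and let $\rho^-,\rho^+$ satisfy $0<\rho^-<\hat\rho<\rho^+<1$ and $f(\rho^-)=f(\rho^+)$. Let $\{\ell_n\}$ be a sequence of positive numbers (car lengths) with $\lim_{n\to\infty}\ell_n=0$. For each $n$, let $P^{(n)}:\mathbb{R}\to(0,1)$ be the discrete stationary profile of the follow-the-leaders model with car length $\ell_n$ (see context) such that $$\lim_{x\to\pm\infty}P^{(n)}(x)=\rho^\pm,\qquad P^{(n)}(0)=\hat\rho.$$ Then, as $n\to\infty$, the sequence $P^{(n)}$ converges pointwise on $\mathbb{R}$ to a unique limit function $Q$, where $Q$ is the stationary profile of the nonlocal conservation law $$\rho_t+\left[\rho(t,x)\, v\left(\int_x^{x+h}\rho(t,y)w(y-x)\,dy\right)\right]_x=0,$$ (see context) satisfying $$\lim_{x\to\pm\infty}Q(x)=\rho^\pm,\qquad Q(0)=\hat\rho.$$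
   Context: Weight function: $w:\mathbb{R}\to[0,\infty)$ is continuous on $[0,h]$, $\int_0^h w(x)\,dx=1$, and $w(x)=0$ for $x\notin[0,h]$ ($w$ may jump at $0$ and $h$). Velocity function: $v\in C^2$ with $v(0)=1$, $v(1)=0$, $v'(\rho)<0$ for all $\rho\in[0,1]$. Stagnation point: it is assumed throughout that $f(\rho)=\rho v(\rho)$ has a unique $\hat\rho\in(0,1)$ with $f'(\hat\rho)=0$, $f'(\rho)>0$ for $\rho<\hat\rho$ and $f'(\rho)<0$ for $\rho>\hat\rho$. Discrete stationary profile for car length $\ell>0$: a continuous monotone increasing function $P:\mathbb{R}\to(0,1)$ satisfying $$P'(x)=-\frac{P^2(x)}{\ell\, v(A^P(x))}\Big[v\big(A^P(L^P(x))\big)-v\big(A^P(x)\big)\Big]\quad\forall x\in\mathbb{R},$$ where $L^P(x)=x+\ell/P(x)$, $(L^P)^k$ is the $k$-fold composition, and $$A^P(x)=\sum_{k=0}^{\infty}\left(\int_{(L^P)^k(x)}^{(L^P)^{k+1}(x)}w(y-x)\,dy\right)P\big((L^P)^k(x)\big).$$ Given the limits $\rho^\pm$ above, such a profile exists and is unique up to horizontal shifts. Stationary profile of the conservation law: a continuous monotone increasing function $Q:\mathbb{R}\to(0,1)$ such that $Q(x)\,v\big(\int_0^hQ(x+s)w(s)\,ds\big)$ is constant in $x\in\mathbb{R}$. Given the limits $\rho^\pm$ above, such a profile exists and is unique up to horizontal shifts. *)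

theory Defs
  imports "HOL-Analysis.Analysis"
begin

definition weight_function :: "real \<Rightarrow> (real \<Rightarrow> real) \<Rightarrow> bool" where
  "weight_function h w \<longleftrightarrow>
     (\<forall>x. 0 \<le> w x) \<and> continuous_on {0..h} w \<and> (w has_integral 1) {0..h} \<and>
     (\<forall>x. x \<notin> {0..h} \<longrightarrow> w x = 0)"

text \<open>
  The velocity is only ever evaluated at densities in [0,1], so the C^2 regularity is required on
  [0,1], with one-sided derivatives at the end points; the values of \<open>v\<close> elsewhere are irrelevant.
\<close>

definition velocity_function :: "(real \<Rightarrow> real) \<Rightarrow> bool" where
  "velocity_function v \<longleftrightarrow>
     v 0 = 1 \<and> v 1 = 0 \<and>
     (\<exists>v' v''.
        (\<forall>\<rho>\<in>{0..1}. (v has_real_derivative v' \<rho>) (at \<rho> within {0..1})) \<and>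
        (\<forall>\<rho>\<in>{0..1}. (v' has_real_derivative v'' \<rho>) (at \<rho> within {0..1})) \<and>
        continuous_on {0..1} v'' \<and>
        (\<forall>\<rho>\<in>{0..1}. v' \<rho> < 0))"

definition flux :: "(real \<Rightarrow> real) \<Rightarrow> real \<Rightarrow> real" where
  "flux v \<rho> = \<rho> * v \<rho>"

text \<open>The sign conditions make the zero of the derivative in (0,1) unique.\<close>

definition stagnation_point :: "(real \<Rightarrow> real) \<Rightarrow> real \<Rightarrow> bool" where
  "stagnation_point v \<rho>h \<longleftrightarrow>
     0 < \<rho>h \<and> \<rho>h < 1 \<and>
     (\<exists>f'. (\<forall>\<rho>\<in>{0..1}. (flux v has_real_derivative f' \<rho>) (at \<rho> within {0..1})) \<and>
           f' \<rho>h = 0 \<and> (\<forall>\<rho>\<in>{0..<\<rho>h}. f' \<rho> > 0) \<and> (\<forall>\<rho>\<in>{\<rho>h<..1}. f' \<rho> < 0))"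

definition leader :: "real \<Rightarrow> (real \<Rightarrow> real) \<Rightarrow> real \<Rightarrow> real" where
  "leader l P x = x + l / P x"

text \<open>
  For a positive \<open>l\<close>, \<open>P\<close> with values in (0,1) and \<open>w\<close> supported in \<open>[0,h]\<close>, consecutive iterates
  of \<open>leader l P\<close> are more than \<open>l\<close> apart, so only finitely many terms of the series are nonzero.
\<close>

definition discrete_average :: "real \<Rightarrow> (real \<Rightarrow> real) \<Rightarrow> (real \<Rightarrow> real) \<Rightarrow> real \<Rightarrow> real" where
  "discrete_average l w P x =
     (\<Sum>k. integral {(leader l P ^^ k) x .. (leader l P ^^ Suc k) x} (\<lambda>y. w (y - x))
            * P ((leader l P ^^ k) x))"

text \<open>In both notions of profile, monotone increasing is read in the non-strict sense.\<close>

definition discrete_stationary_profile ::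
  "real \<Rightarrow> (real \<Rightarrow> real) \<Rightarrow> (real \<Rightarrow> real) \<Rightarrow> (real \<Rightarrow> real) \<Rightarrow> bool" where
  "discrete_stationary_profile l w v P \<longleftrightarrow>
     continuous_on UNIV P \<and> mono P \<and> (\<forall>x. 0 < P x \<and> P x < 1) \<and>
     (\<forall>x. (P has_real_derivative
            - ((P x)\<^sup>2 / (l * v (discrete_average l w P x)))
              * (v (discrete_average l w P (leader l P x)) - v (discrete_average l w P x))) (at x))"

definition stationary_profile ::
  "real \<Rightarrow> (real \<Rightarrow> real) \<Rightarrow> (real \<Rightarrow> real) \<Rightarrow> (real \<Rightarrow> real) \<Rightarrow> bool" where
  "stationary_profile h w v Q \<longleftrightarrow>
     continuous_on UNIV Q \<and> mono Q \<and> (\<forall>x. 0 < Q x \<and> Q x < 1) \<and>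
     (\<exists>c. \<forall>x. Q x * v (integral {0..h} (\<lambda>s. Q (x + s) * w s)) = c)"

text \<open>The horizontal normalisation at 0 singles out one profile among its translates.\<close>

definition normalised_between :: "real \<Rightarrow> real \<Rightarrow> real \<Rightarrow> (real \<Rightarrow> real) \<Rightarrow> bool" where
  "normalised_between \<rho>m \<rho>p \<rho>h P \<longleftrightarrow>
     (P \<longlongrightarrow> \<rho>m) at_bot \<and> (P \<longlongrightarrow> \<rho>p) at_top \<and> P 0 = \<rho>h"

end

theory Submission
  imports Defs "HOL-Probability.Helly_Selection"
begin

text \<open>
  Write \<open>W\<close> for averaging against the weight, called \<open>avg\<close> below, and \<open>c\<close> for the common flux of
  the two limits. The travel time from a car to its leader does not depend on the position of the
  car, which turns the discrete equation into \<open>c / v (W P (x - \<epsilon>)) \<le> P x \<le> c / v (W P (x + \<epsilon>))\<close>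
  with \<open>\<epsilon>\<close> proportional to the car length. By Helly's theorem every subsequence has a further
  subsequence that converges almost everywhere, hence by the bounds everywhere, to a continuous
  solution of \<open>Q = c / v (W Q)\<close>; its limits are right because the flux takes the value \<open>c\<close> only once
  on either side of the stagnation point. The whole sequence converges since the profile is unique.

  For uniqueness, solutions ordered on a window of length \<open>h\<close> remain ordered to the left of it, so
  only the behaviour near plus infinity matters. There the deficit \<open>u = \<rho>p - Q\<close>, rescaled to be \<open>1\<close>
  at a point that moves to plus infinity, is precompact with limits among the positive decreasing
  solutions of the linear equation \<open>U = g * W U\<close>, \<open>U 0 = 1\<close>, with \<open>g > 1\<close>. This \<open>U\<close> is unique: a
  solution of extremal growth over a step is multiplicative under that step by a strong maximum
  principle, and backward comparison forces equality of the largest and the smallest growth rate.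
  Hence two profiles aligned far to the right have nearly proportional deficits, arbitrarily small
  shifts order them, and the normalisation at the origin makes them equal.
\<close>

section \<open>Limits of monotone functions\<close>

text \<open>Otherwise infinitely many terms stay at distance at least \<open>e\<close> from
  \<open>L\<close>, and the subsequence enumerating them has no further subsequence tending to
  \<open>L\<close>. This is how compactness together with uniqueness of the limit yields convergence
  of a whole sequence.\<close>

lemma subseq_principle:
  fixes f :: "nat \<Rightarrow> real"
  assumes "\<And>s :: nat \<Rightarrow> nat. strict_mono s \<Longrightarrow> \<exists>t. strict_mono t \<and> (\<lambda>n. f (s (t n))) \<longlonglongrightarrow> L"
  shows "f \<longlonglongrightarrow> L"
proof (rule ccontr)
  assume "\<not> ?thesis"
  then obtain e where e: "e > 0" "\<not> (\<forall>\<^sub>F n in sequentially. dist (f n) L < e)"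
    unfolding tendsto_iff by blast
  then have inf: "infinite {n. \<not> dist (f n) L < e}"
    by (simp add: eventually_cofinite[symmetric] cofinite_eq_sequentially[symmetric])
  define s where "s = enumerate {n. \<not> dist (f n) L < e}"
  have s: "strict_mono s" "\<And>n. \<not> dist (f (s n)) L < e"
    using strict_mono_enumerate[OF inf] enumerate_in_set[OF inf] by (auto simp: s_def)
  obtain t where "(\<lambda>n. f (s (t n))) \<longlonglongrightarrow> L"
    using assms[OF s(1)] by blast
  then have "\<forall>\<^sub>F n in sequentially. dist (f (s (t n))) L < e"
    using e(1) by (auto simp: tendsto_iff)
  then show False
    using s(2) by (auto simp: eventually_sequentially)
qed

text \<open>The arc tangent reduces Helly's theorem for pointwise bounded sequences to the uniformly
  bounded case.\<close>

lemma helly_pointwise_bounded: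
  fixes f :: "nat \<Rightarrow> real \<Rightarrow> real"
  assumes cont: "\<And>n. continuous_on UNIV (f n)" and mono: "\<And>n. mono (f n)"
    and bdd: "\<And>x. Bseq (\<lambda>n. f n x)"
  obtains s F D where "strict_mono (s :: nat \<Rightarrow> nat)" "mono F" "countable D"
    "\<And>x. x \<notin> D \<Longrightarrow> (\<lambda>n. f (s n) x) \<longlonglongrightarrow> F x"
proof -
  have "isCont (\<lambda>x. arctan (f n x)) x" for n x
    using cont[of n] by (auto intro!: continuous_intros simp: continuous_on_eq_continuous_at)
  then have 1: "continuous (at_right x) (\<lambda>x. arctan (f n x))" for n x
    using continuous_at_imp_continuous_within by blast
  have 2: "mono (\<lambda>x. arctan (f n x))" for n
    using mono[of n] by (auto simp: mono_def arctan_monotone')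
  have 3: "\<bar>arctan (f n x)\<bar> \<le> pi / 2" for n x
    using arctan_bounded[of "f n x"] by linarith
  obtain s H where s: "strict_mono (s :: nat \<Rightarrow> nat)" and H: "mono H"
    "\<And>x. isCont H x \<Longrightarrow> (\<lambda>n. arctan (f (s n) x)) \<longlonglongrightarrow> H x"
    using Helly_selection[of "\<lambda>n x. arctan (f n x)", OF 1 2 3] by metis
  note ctble = mono_ctble_discont[OF H(1)]
  \<comment> \<open>Boundedness at \<open>x\<close> keeps the limit of the arc tangents away from
    the end points, so that \<open>tan\<close> inverts it.\<close>
  have range: "- (pi/2) < H x \<and> H x < pi/2" if x: "isCont H x" for x
  proof -
    obtain K where K: "\<And>n. \<bar>f n x\<bar> \<le> K"
      using bdd[of x] unfolding Bseq_def by auto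
    have "- arctan K \<le> arctan (f (s n) x)" "arctan (f (s n) x) \<le> arctan K" for n
      using K[of "s n"] by (auto simp: arctan_minus[symmetric] arctan_le_iff)
    then have "- arctan K \<le> H x" "H x \<le> arctan K"
      using LIMSEQ_le_const[OF H(2)[OF x]] LIMSEQ_le_const2[OF H(2)[OF x]] by blast+
    then show ?thesis
      using arctan_bounded[of K] by linarith
  qed
  \<comment> \<open>Continuity points lie on both sides of every \<open>x\<close>, and monotonicity
    transfers the strict bounds from them.\<close>
  have range': "- (pi/2) < H x" "H x < pi/2" for x
  proof -
    obtain a where "a < x" "isCont H a"
      using open_minus_countable[OF ctble, of "{..<x}"] by auto
    moreover obtain b where "x < b" "isCont H b"
      using open_minus_countable[OF ctble, of "{x<..}"] by auto
    ultimately show "- (pi/2) < H x" "H x < pi/2"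
      using range[of a] range[of b] monoD[OF H(1), of a x] monoD[OF H(1), of x b] by linarith+
  qed
  show thesis
  proof (rule that[of s "\<lambda>x. tan (H x)" "{x. \<not> isCont H x}"])
    show "mono (\<lambda>x. tan (H x))"
    proof (rule monoI)
      fix x y :: real assume "x \<le> y"
      then have "H x \<le> H y"
        by (rule monoD[OF H(1)])
      then show "tan (H x) \<le> tan (H y)"
        using range'(1)[of x] range'(2)[of y] tan_monotone[of "H x" "H y"] by (cases "H x = H y") auto
    qed
    fix x assume "x \<notin> {x. \<not> isCont H x}"
    then have lim: "(\<lambda>n. arctan (f (s n) x)) \<longlonglongrightarrow> H x"
      using H(2) by simp
    have "isCont tan (H x)"
      using cos_gt_zero_pi[of "H x"] range'[of x] by (intro isCont_tan) simp
    from isCont_tendsto_compose[OF this lim]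
    show "(\<lambda>n. f (s n) x) \<longlonglongrightarrow> tan (H x)"
      by (simp add: tan_arctan)
  qed (rule s ctble)+
qed

text \<open>The derivatives of the velocity and of the flux are known only within the unit interval,
  hence one-sided at its ends.\<close>

lemma mvt_unit_interval:
  assumes "0 \<le> a" "a < b" "b \<le> 1"
    and "\<And>\<rho>. \<rho> \<in> {0..1} \<Longrightarrow> (f has_real_derivative f' \<rho>) (at \<rho> within {0..1})"
  obtains z where "a < z" "z < b" "f b - f a = (b - a) * f' z"
proof -
  have "\<exists>z\<in>{a<..<b}. f b - f a = (\<lambda>h. f' z * h) (b - a)"
  proof (rule mvt_simple[OF assms(2)])
    fix x assume "a \<le> x" "x \<le> b"
    then show "(f has_derivative (*) (f' x)) (at x within {a..b})"
      using assms(1,3) unfolding has_field_derivative_def[symmetric]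
      by (intro has_field_derivative_subset[OF assms(4)]) auto
  qed
  then show thesis
    using that by (auto simp: mult.commute)
qed

section \<open>Averaging against the weight\<close>

locale averaging =
  fixes h :: real and w :: "real \<Rightarrow> real"
  assumes h_pos: "0 < h" and weight: "weight_function h w"
begin

definition avg :: "(real \<Rightarrow> real) \<Rightarrow> real \<Rightarrow> real" where
  "avg f x = integral {0..h} (\<lambda>s. f (x + s) * w s)"

text \<open>The integral takes a default value on functions that are not integrable, so linearity
  and monotonicity of \<open>avg\<close> carry this side condition. Continuous and monotone
  functions satisfy it.\<close>

definition avg_integrable :: "(real \<Rightarrow> real) \<Rightarrow> bool" where
  "avg_integrable f \<longleftrightarrow> (\<forall>x. (\<lambda>s. f (x + s) * w s) integrable_on {0..h})"

lemma w_nonneg: "0 \<le> w s"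
  and w_cont: "continuous_on {0..h} w"
  and w_integral: "(w has_integral 1) {0..h}"
  and w_outside: "s \<notin> {0..h} \<Longrightarrow> w s = 0"
  using weight unfolding weight_function_def by auto

lemma w_bounded: obtains B where "B > 0" "\<And>s. w s \<le> B"
proof -
  have "compact (w ` {0..h})"
    by (intro compact_continuous_image w_cont) auto
  then obtain B where B: "\<And>s. s \<in> {0..h} \<Longrightarrow> norm (w s) \<le> B"
    by (meson bounded_iff compact_imp_bounded imageI)
  have "w s \<le> max B 1" for s
    using B[of s] w_outside[of s] by (cases "s \<in> {0..h}") auto
  then show thesis
    using that[of "max B 1"] by auto
qed

text \<open>A weight vanishing on the open interval would have integral 0, and continuity turns one
  positive value into an interval of them. That \<open>a\<close> is positive forces zeros to travel
  to the right in \<open>vanishing_propagates\<close>.\<close>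

lemma w_positive_interval:
  obtains a b where "0 < a" "a < b" "b \<le> h" "\<And>s. s \<in> {a..b} \<Longrightarrow> 0 < w s"
proof -
  have "\<exists>s\<in>{0<..<h}. w s \<noteq> 0"
  proof (rule ccontr)
    assume "\<not> ?thesis"
    then have z: "w s = 0" if "s \<in> {0..h} - {0,h}" for s
      using that by auto
    have "(w has_integral 0) {0..h}"
      by (rule has_integral_spike_finite[of "{0,h}" _ w "\<lambda>_. 0"]) (use z in auto)
    then have "1 = (0::real)"
      by (rule has_integral_unique[OF w_integral])
    then show False
      by simp
  qed
  then obtain s0 where "s0 \<in> {0<..<h}" "w s0 \<noteq> 0"
    by blast
  then have s0: "0 < s0" "s0 < h" "w s0 > 0"
    using w_nonneg[of s0] by auto
  have "isCont w s0"
    using continuous_on_interior[OF w_cont] s0 by simp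
  then have "\<forall>\<^sub>F s in at s0. w s > 0"
    using s0(3) by (auto simp: isCont_def intro: order_tendstoD)
  then obtain d where d: "d > 0" "\<And>s. s \<noteq> s0 \<Longrightarrow> dist s s0 < d \<Longrightarrow> w s > 0"
    unfolding eventually_at by auto
  \<comment> \<open>Half the radius of positivity makes the closed interval admissible, and
    \<open>h - s0\<close> keeps it in the support.\<close>
  define e where "e = min (d/2) (h - s0)"
  have e: "0 < e" "e \<le> d/2" "e \<le> h - s0"
    using d(1) s0 unfolding e_def by linarith+
  show thesis
  proof (rule that[of s0 "s0 + e"])
    show "0 < w s" if "s \<in> {s0..s0 + e}" for s
      using that e d s0(3) by (cases "s = s0") (auto simp: dist_real_def)
  qed (use e s0 in auto)
qed

lemma avg_integrable_continuous:
  assumes "continuous_on UNIV f"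
  shows "avg_integrable f"
  unfolding avg_integrable_def
proof
  fix x
  have "continuous_on {0..h} (\<lambda>s. f (x + s) * w s)"
    by (intro continuous_intros w_cont continuous_on_compose2[OF assms]) auto
  then show "(\<lambda>s. f (x + s) * w s) integrable_on {0..h}"
    by (rule integrable_continuous_real)
qed

text \<open>The second mean value theorem for a monotone factor includes the integrability of the
  product.\<close>

lemma avg_integrable_mono:
  assumes "mono f"
  shows "avg_integrable f"
  unfolding avg_integrable_def
proof
  fix x
  obtain c where "((\<lambda>s. f (x + s) *\<^sub>R w s) has_integral
      (f (x + 0) *\<^sub>R integral {0..c} w + f (x + h) *\<^sub>R integral {c..h} w)) {0..h}"
    by (rule second_mean_value_theorem_full[of w 0 h "\<lambda>s. f (x + s)"])
      (use w_integral h_pos monoD[OF assms] in \<open>auto simp: has_integral_iff\<close>)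
  then show "(\<lambda>s. f (x + s) * w s) integrable_on {0..h}"
    by (auto simp: has_integral_iff)
qed

lemma avg_integrable_minus: "avg_integrable f \<Longrightarrow> avg_integrable (\<lambda>x. - f x)"
  unfolding avg_integrable_def minus_mult_left[symmetric] by (simp add: integrable_neg)

lemma avg_integrable_antimono:
  assumes "antimono f"
  shows "avg_integrable f"
proof -
  have "mono (\<lambda>x. - f x)"
    using assms by (simp add: monotone_def)
  from avg_integrable_minus[OF avg_integrable_mono[OF this]] show ?thesis
    by simp
qed

lemma avg_integrable_cmult: "avg_integrable f \<Longrightarrow> avg_integrable (\<lambda>x. c * f x)"
  unfolding avg_integrable_def mult.assoc by (simp add: integrable_on_mult_right)

lemma avg_integrable_shift: "avg_integrable f \<Longrightarrow> avg_integrable (\<lambda>x. f (t + x))"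
  unfolding avg_integrable_def by (auto simp: add.assoc[symmetric])

lemma avg_integrable_const: "avg_integrable (\<lambda>_. c)"
  by (rule avg_integrable_continuous) auto

lemma avg_shift: "avg (\<lambda>x. f (t + x)) x = avg f (t + x)"
  unfolding avg_def by (simp add: add.assoc)

lemma avg_const: "avg (\<lambda>_. c) x = c"
proof -
  have "((\<lambda>s. c * w s) has_integral c * 1) {0..h}"
    by (rule has_integral_mult_right[OF w_integral])
  then show ?thesis
    unfolding avg_def by (rule integral_unique[THEN trans]) simp
qed

lemma avg_cmult: "avg (\<lambda>x. c * f x) x = c * avg f x"
  unfolding avg_def by (simp add: mult.assoc)

lemma avg_diff:
  "avg_integrable f \<Longrightarrow> avg_integrable g \<Longrightarrow> avg (\<lambda>x. f x - g x) x = avg f x - avg g x"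
  unfolding avg_def avg_integrable_def by (simp add: left_diff_distrib integral_diff)

lemma avg_minus: "avg (\<lambda>x. - f x) x = - avg f x"
  using avg_cmult[of "-1" f x] by simp

lemma avg_le:
  assumes "avg_integrable f" "avg_integrable g" "\<And>s. s \<in> {0..h} \<Longrightarrow> f (x + s) \<le> g (y + s)"
  shows "avg f x \<le> avg g y"
  unfolding avg_def
  by (rule integral_le)
    (use assms w_nonneg in \<open>auto simp: avg_integrable_def intro!: mult_right_mono\<close>)

lemma avg_bounds:
  assumes "avg_integrable f" "\<And>s. s \<in> {0..h} \<Longrightarrow> a \<le> f (x + s)" "\<And>s. s \<in> {0..h} \<Longrightarrow> f (x + s) \<le> b"
  shows "a \<le> avg f x" "avg f x \<le> b"
  using avg_le[OF avg_integrable_const assms(1), of a x x] avg_le[OF assms(1) avg_integrable_const, of x b x]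
    assms(2,3) by (auto simp: avg_const)

text \<open>By compactness the minimum over the window is attained, hence positive, and the average
  is at least this minimum.\<close>

lemma avg_pos:
  assumes "continuous_on UNIV f" "\<And>s. s \<in> {0..h} \<Longrightarrow> 0 < f (x + s)"
  shows "0 < avg f x"
proof -
  have "continuous_on {0..h} (\<lambda>s. f (x + s))"
    by (intro continuous_intros continuous_on_compose2[OF assms(1)]) auto
  then obtain s0 where s0: "s0 \<in> {0..h}" "\<And>s. s \<in> {0..h} \<Longrightarrow> f (x + s0) \<le> f (x + s)"
    using continuous_attains_inf[of "{0..h}" "\<lambda>s. f (x + s)"] h_pos by auto
  have "f (x + s0) \<le> avg f x"
    using avg_le[OF avg_integrable_const avg_integrable_continuous[OF assms(1)], of "f (x + s0)" x x] s0
    by (auto simp: avg_const)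
  then show ?thesis
    using assms(2)[OF s0(1)] by simp
qed

lemma avg_eq_0_imp:
  assumes cont: "continuous_on UNIV f" and nonneg: "\<And>s. s \<in> {0..h} \<Longrightarrow> 0 \<le> f (x + s)"
    and zero: "avg f x = 0" and s: "s \<in> {0..h}" "0 < w s"
  shows "f (x + s) = 0"
proof -
  have "continuous_on {0..h} (\<lambda>s. f (x + s) * w s)"
    by (intro continuous_intros w_cont continuous_on_compose2[OF cont]) auto
  then have "f (x + s) * w s = 0"
    using integral_eq_0_iff[of 0 h "\<lambda>s. f (x + s) * w s"] zero nonneg w_nonneg h_pos s(1)
    by (simp add: avg_def)
  then show ?thesis
    using s(2) by simp
qed

lemma weighted_has_integral:
  assumes "avg_integrable f" "h \<le> T"
  shows "((\<lambda>s. f (x + s) * w s) has_integral avg f x) {0..T}"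
proof (rule has_integral_on_superset)
  show "((\<lambda>s. f (x + s) * w s) has_integral avg f x) {0..h}"
    using assms(1) unfolding avg_def avg_integrable_def by (blast intro: integrable_integral)
qed (use assms(2) w_outside in auto)

lemma weighted_integrable:
  assumes "avg_integrable f" "0 \<le> a"
  shows "(\<lambda>s. f (x + s) * w s) integrable_on {a..b}"
proof (rule integrable_on_subinterval)
  show "(\<lambda>s. f (x + s) * w s) integrable_on {0..max b h}"
    using weighted_has_integral[OF assms(1), of "max b h" x] by (auto simp: has_integral_integrable)
qed (use assms(2) in auto)

lemma w_integrable: "0 \<le> a \<Longrightarrow> w integrable_on {a..b}"
  using weighted_integrable[OF avg_integrable_const[of 1], of a b] by simp

text \<open>The cumulative distribution function of the weight. The cap at \<open>h\<close> reduces
  its continuity to that of a primitive on one compact interval.\<close>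

definition mass :: "real \<Rightarrow> real" where
  "mass t = integral {0..min t h} w"

lemma mass_eq:
  assumes "0 \<le> t"
  shows "integral {0..t} w = mass t"
proof (cases "t \<le> h")
  case False
  then have "integral {0..t} w = avg (\<lambda>_. 1) 0" "integral {0..h} w = avg (\<lambda>_. 1) 0"
    using weighted_has_integral[OF avg_integrable_const[of 1], of t 0]
      weighted_has_integral[OF avg_integrable_const[of 1], of h 0] by (auto simp: integral_unique)
  then show ?thesis
    using False by (simp add: mass_def)
qed (simp add: mass_def)

lemma mass_diff:
  assumes "0 \<le> a" "a \<le> b"
  shows "integral {a..b} w = mass b - mass a"
  using Henstock_Kurzweil_Integration.integral_combine[OF assms w_integrable] mass_eq[of a] mass_eq[of b] assms by simp

lemma mass_continuous:
  assumes "continuous_on S f" "\<And>x. x \<in> S \<Longrightarrow> 0 \<le> f x"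
  shows "continuous_on S (\<lambda>x. mass (f x))"
  unfolding mass_def
proof (rule continuous_on_compose2[of "{0..h}" "\<lambda>t. integral {0..t} w"])
  show "continuous_on {0..h} (\<lambda>t. integral {0..t} w)"
    by (rule indefinite_integral_continuous_1[OF w_integrable]) simp
qed (use assms h_pos in \<open>auto intro!: continuous_intros\<close>)

text \<open>Dominated convergence with majorant \<open>B * w\<close>. The exceptional set
  \<open>D\<close> accommodates limits from Helly's theorem, and the bound need only hold
  eventually, as for the rescaled deficits.\<close>

lemma avg_tendsto:
  assumes int: "\<And>n. avg_integrable (f n)" and D: "countable D"
    and lim: "\<And>y. y \<notin> D \<Longrightarrow> (\<lambda>n. f n y) \<longlonglongrightarrow> F y"
    and bdd: "\<forall>\<^sub>F n in sequentially. \<forall>s\<in>{0..h}. \<bar>f n (x + s)\<bar> \<le> B"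
  shows "(\<lambda>s. F (x + s) * w s) integrable_on {0..h}" "(\<lambda>n. avg (f n) x) \<longlonglongrightarrow> avg F x"
proof -
  obtain N where N: "\<And>n s. n \<ge> N \<Longrightarrow> s \<in> {0..h} \<Longrightarrow> \<bar>f n (x + s)\<bar> \<le> B"
    using bdd unfolding eventually_sequentially by blast
  define E where "E = (\<lambda>y. y - x) ` D"
  have E: "negligible E"
    using D unfolding E_def negligible_iff_null_sets
    by (intro null_sets_completionI countable_imp_null_set_lborel countable_image)
  have notE: "x + s \<notin> D" if "s \<notin> E" for s
    using that unfolding E_def by (metis add_diff_cancel_left' imageI)
  \<comment> \<open>Dominated convergence is applied with bounds at every index and limits at every
    point: the index is shifted past \<open>N\<close> and the integrands are set to 0 on the null
    set \<open>E\<close>.\<close>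
  define g where "g n s = (if s \<in> E then 0 else f (n + N) (x + s) * w s)" for n s
  define G where "G s = (if s \<in> E then 0 else F (x + s) * w s)" for s
  have g_int: "g n integrable_on {0..h}" for n
    by (rule integrable_spike[of "\<lambda>s. f (n + N) (x + s) * w s" _ E])
      (use int E in \<open>auto simp: avg_integrable_def g_def\<close>)
  have g_le: "norm (g n s) \<le> B * w s" if "s \<in> {0..h}" for n s
  proof -
    have "\<bar>f (n + N) (x + s)\<bar> \<le> B"
      using N[of "n + N" s] that by simp
    moreover from this have "0 \<le> B"
      by linarith
    ultimately show ?thesis
      using w_nonneg[of s] by (simp add: g_def abs_mult mult_right_mono)
  qed
  have g_lim: "(\<lambda>n. g n s) \<longlonglongrightarrow> G s" for s
  proof (cases "s \<in> E")
    case False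
    then have "(\<lambda>n. f (n + N) (x + s) * w s) \<longlonglongrightarrow> F (x + s) * w s"
      by (intro tendsto_mult_right LIMSEQ_ignore_initial_segment lim notE)
    then show ?thesis
      using False by (simp add: g_def G_def)
  qed (simp add: g_def G_def)
  have Bw: "(\<lambda>s. B * w s) integrable_on {0..h}"
    using w_integral has_integral_mult_right by blast
  note dc = dominated_convergence[of g "{0..h}" "\<lambda>s. B * w s" G, OF g_int Bw g_le g_lim]
  show "(\<lambda>s. F (x + s) * w s) integrable_on {0..h}"
    by (rule integrable_spike[OF dc(1) E]) (auto simp: G_def)
  have "integral {0..h} (g n) = avg (f (n + N)) x" for n
    unfolding avg_def by (rule integral_spike[OF E]) (auto simp: g_def)
  moreover have "integral {0..h} G = avg F x"
    unfolding avg_def by (rule integral_spike[OF E]) (auto simp: G_def)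
  ultimately have "(\<lambda>n. avg (f (n + N)) x) \<longlonglongrightarrow> avg F x"
    using dc(2) by simp
  then show "(\<lambda>n. avg (f n) x) \<longlonglongrightarrow> avg F x"
    by (rule LIMSEQ_offset)
qed

text \<open>The function may jump, but only at countably many points, and its translates converge at
  all others. Averaging thus makes Helly limits continuous.\<close>

lemma avg_continuous:
  assumes "mono f"
  shows "continuous_on UNIV (avg f)"
proof (rule continuous_at_imp_continuous_on, rule ballI)
  fix x
  show "isCont (avg f) x"
    unfolding continuous_at_sequentially
  proof (intro allI impI)
    fix X assume X: "X \<longlonglongrightarrow> x"
    define D where "D = {y. \<not> isCont f y}"
    have shift: "(\<lambda>n. avg (\<lambda>y. f (X n - x + y)) x) \<longlonglongrightarrow> avg f x"
    proof (rule avg_tendsto(2)[of "\<lambda>n y. f (X n - x + y)" D f x "\<bar>f (x - 1)\<bar> + \<bar>f (x + 1 + h)\<bar>"])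
      show "avg_integrable (\<lambda>y. f (X n - x + y))" for n
        by (intro avg_integrable_shift avg_integrable_mono assms)
      show "countable D"
        unfolding D_def by (rule mono_ctble_discont[OF assms])
      show "(\<lambda>n. f (X n - x + y)) \<longlonglongrightarrow> f y" if "y \<notin> D" for y
      proof (rule isCont_tendsto_compose[of y f])
        have "(\<lambda>n. X n - x + y) \<longlonglongrightarrow> x - x + y"
          by (intro tendsto_intros X)
        then show "(\<lambda>n. X n - x + y) \<longlonglongrightarrow> y" by simp
      qed (use that in \<open>simp add: D_def\<close>)
      have "\<forall>\<^sub>F n in sequentially. dist (X n) x < 1"
        using X by (auto simp: tendsto_iff)
      then show "\<forall>\<^sub>F n in sequentially. \<forall>s\<in>{0..h}. \<bar>f (X n - x + (x + s))\<bar> \<le> \<bar>f (x - 1)\<bar> + \<bar>f (x + 1 + h)\<bar>"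
      proof eventually_elim
        case (elim n)
        show ?case
        proof
          fix s assume "s \<in> {0..h}"
          then have "f (x - 1) \<le> f (X n + s)" "f (X n + s) \<le> f (x + 1 + h)"
            using elim by (auto intro!: monoD[OF assms] simp: dist_real_def)
          then show "\<bar>f (X n - x + (x + s))\<bar> \<le> \<bar>f (x - 1)\<bar> + \<bar>f (x + 1 + h)\<bar>"
            by (simp add: algebra_simps)
        qed
      qed
    qed
    then show "(avg f \<circ> X) \<longlonglongrightarrow> avg f x"
      by (simp add: avg_shift o_def)
  qed
qed

section \<open>Comparison and decay profiles\<close>

text \<open>On a step of length \<open>d\<close> to the left of the window a positive maximum of \<open>F\<close> would be at most
  half of itself, since only a mass of at most \<open>1 / (2 * L)\<close> of the weight can see positive values.\<close>

lemma backward_comparison: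
  assumes cont: "continuous_on UNIV F" and L: "0 < L"
    and step: "\<And>x. 0 < F x \<Longrightarrow> F x \<le> L * avg F x"
    and init: "\<And>y. y \<in> {x0..x0 + h} \<Longrightarrow> F y \<le> 0" and x: "x \<le> x0 + h"
  shows "F x \<le> 0"
proof -
  obtain B where B: "B > 0" "\<And>s. w s \<le> B"
    by (rule w_bounded) blast
  define d where "d = min h (1 / (2 * L * B))"
  have d: "0 < d" "d \<le> h" "d \<le> 1 / (2 * L * B)"
    using B L h_pos by (auto simp: d_def)
  have LBd: "L * (B * d) \<le> 1/2"
    using d(3) B(1) L by (simp add: field_simps)
  have extend: "F y \<le> 0" if z: "\<And>y. y \<in> {z..z + h} \<Longrightarrow> F y \<le> 0" and y: "y \<in> {z - d..z + h}" for y z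
  proof -
    obtain x1 where x1: "x1 \<in> {z - d..z}" "\<And>y. y \<in> {z - d..z} \<Longrightarrow> F y \<le> F x1"
      using continuous_attains_sup[of "{z - d..z}" F] d(1) continuous_on_subset[OF cont] by auto
    have "F x1 \<le> 0"
    proof (rule ccontr)
      assume "\<not> ?thesis"
      then have pos: "0 < F x1" by simp
      have "((\<lambda>_. F x1 * B) has_integral (F x1 * B * d)) {0..d}"
        using has_integral_const_real[of "F x1 * B" 0 d] d(1) by (simp add: mult.commute)
      then have "((\<lambda>s. if s \<in> {0..d} then F x1 * B else 0) has_integral (F x1 * B * d)) {0..h}"
        using has_integral_restrict[of "{0..d}" "{0..h}" "\<lambda>_. F x1 * B"] d(2) by simp
      moreover have "((\<lambda>s. F (x1 + s) * w s) has_integral avg F x1) {0..h}"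
        using avg_integrable_continuous[OF cont] unfolding avg_def avg_integrable_def
        by (blast intro: integrable_integral)
      \<comment> \<open>Up to \<open>d\<close> the value at \<open>x1 + s\<close> is at most the
        maximum \<open>F x1\<close>; beyond \<open>d\<close> the point \<open>x1 + s\<close> has
        entered the window, where \<open>F\<close> is not positive.\<close>
      moreover have "F (x1 + s) * w s \<le> (if s \<in> {0..d} then F x1 * B else 0)" if s: "s \<in> {0..h}" for s
      proof (cases "s \<le> d")
        case True
        have "F (x1 + s) \<le> F x1"
        proof (cases "x1 + s \<le> z")
          case False
          then have "F (x1 + s) \<le> 0"
            using x1(1) s by (intro z) auto
          then show ?thesis using pos by simp
        qed (use x1 s in auto)
        then have "F (x1 + s) * w s \<le> F x1 * w s"
          by (rule mult_right_mono) (rule w_nonneg)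
        also have "\<dots> \<le> F x1 * B"
          using B(2) pos by (intro mult_left_mono) auto
        finally show ?thesis using True s by simp
      next
        case False
        then have "F (x1 + s) \<le> 0"
          using x1(1) s by (intro z) auto
        then show ?thesis
          using False w_nonneg[of s] by (simp add: mult_nonpos_nonneg)
      qed
      ultimately have "avg F x1 \<le> F x1 * B * d"
        using has_integral_le by blast
      then have "L * avg F x1 \<le> F x1 * (L * (B * d))"
        using L by (simp add: mult.commute mult.left_commute mult_left_mono)
      also have "\<dots> \<le> F x1 * (1/2)"
        using LBd pos by (intro mult_left_mono) auto
      finally show False
        using step[OF pos] pos by simp
    qed
    then show ?thesis
      using x1(2)[of y] z[of y] y by (cases "y \<le> z") auto
  qed
  have iter: "\<forall>y \<in> {x0 - real n * d..x0 + h}. F y \<le> 0" for n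
  proof (induction n)
    case (Suc n)
    show ?case
    proof
      fix y assume y: "y \<in> {x0 - real (Suc n) * d..x0 + h}"
      show "F y \<le> 0"
      proof (cases "x0 - real n * d \<le> y")
        case False
        show ?thesis
        proof (rule extend[of "x0 - real n * d"])
          show "F y' \<le> 0" if "y' \<in> {x0 - real n * d..x0 - real n * d + h}" for y'
          proof -
            have "0 \<le> real n * d"
              using d(1) by simp
            then show ?thesis
              using that by (intro Suc.IH[rule_format]) auto
          qed
          show "y \<in> {x0 - real n * d - d..x0 - real n * d + h}"
            using y False h_pos by (simp add: algebra_simps)
        qed
      qed (use Suc.IH y in auto)
    qed
  qed (use init in auto)
  obtain n :: nat where "real n * d \<ge> x0 - x"
    using reals_Archimedean3[OF d(1)] by (meson less_imp_le)
  then show ?thesis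
    using iter[of n] x by force
qed

text \<open>Zeros spread to the right over the multiples of an interval where the weight is positive; these
  eventually have length \<open>h\<close>, and from there zeros spread to the left by comparison.\<close>

lemma vanishing_propagates:
  assumes cont: "continuous_on UNIV F" and L: "0 < L" and nonneg: "\<And>x. 0 \<le> F x"
    and le: "\<And>x. F x \<le> L * avg F x" and zero: "\<And>x. F x = 0 \<Longrightarrow> avg F x = 0"
    and x0: "F x0 = 0"
  shows "F x = 0"
proof -
  obtain a b where ab: "0 < a" "a < b" "b \<le> h" "\<And>s. s \<in> {a..b} \<Longrightarrow> 0 < w s"
    by (rule w_positive_interval) blast
  have spread: "\<forall>y \<in> {x0 + real k * a..x0 + real k * b}. F y = 0" for k
  proof (induction k)
    case (Suc k)
    show ?case
    proof
      fix y assume y: "y \<in> {x0 + real (Suc k) * a..x0 + real (Suc k) * b}"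
      \<comment> \<open>The smallest point of the interval for \<open>k\<close> from which
        \<open>y\<close> is reached by a step of at most \<open>b\<close>; this step is then also at
        least \<open>a\<close>.\<close>
      define z where "z = max (x0 + real k * a) (y - b)"
      have "real k * a \<le> real k * b"
        using ab by (intro mult_left_mono) auto
      then have z: "z \<in> {x0 + real k * a..x0 + real k * b}" "y - z \<in> {a..b}"
        using y ab by (auto simp: z_def algebra_simps)
      have "avg F z = 0"
        using Suc.IH z(1) zero by blast
      then have "F (z + (y - z)) = 0"
        using z(2) ab by (intro avg_eq_0_imp[OF cont nonneg]) auto
      then show "F y = 0"
        by simp
    qed
  qed (simp add: x0)
  \<comment> \<open>\<open>k1\<close> makes the interval of zeros at least \<open>h\<close> long,
    and \<open>k2\<close> moves its left end to the right of \<open>x\<close>.\<close>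
  obtain k1 :: nat where k1: "h \<le> real k1 * (b - a)"
    using reals_Archimedean3[of "b - a"] ab by (meson less_imp_le diff_gt_0_iff_gt)
  obtain k2 :: nat where k2: "x - x0 \<le> real k2 * a"
    using reals_Archimedean3[OF ab(1)] by (meson less_imp_le)
  define k where "k = k1 + k2"
  have k: "h \<le> real k * (b - a)" "x - x0 \<le> real k * a"
  proof -
    have "0 \<le> real k2 * (b - a)" "0 \<le> real k1 * a"
      using ab by auto
    then show "h \<le> real k * (b - a)" "x - x0 \<le> real k * a"
      using k1 k2 unfolding k_def of_nat_add distrib_right by linarith+
  qed
  have "F x \<le> 0"
  proof (rule backward_comparison[OF cont L])
    show "F y \<le> L * avg F y" for y
      by (rule le)
    show "F y \<le> 0" if "y \<in> {x0 + real k * a..x0 + real k * a + h}" for y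
      using spread[of k] that k(1) by (auto simp: right_diff_distrib)
    show "x \<le> x0 + real k * a + h"
      using k(2) h_pos by simp
  qed
  then show ?thesis
    using nonneg[of x] by simp
qed

text \<open>The part of the average over the first \<open>d\<close> contributes at most half of
  \<open>F x\<close>, which is absorbed on the left; the remaining part sees values at most
  \<open>F (x + d)\<close>. The constants depend only on \<open>L\<close> and the weight, which
  makes the bounds uniform over families of functions.\<close>

lemma harnack:
  assumes L: "0 < L"
  obtains d C where "0 < d" "0 < C"
    "\<And>F x. antimono F \<Longrightarrow> (\<And>y. 0 \<le> F y) \<Longrightarrow> F x \<le> L * avg F x \<Longrightarrow> F x \<le> C * F (x + d)"
proof -
  obtain B where B: "B > 0" "\<And>s. w s \<le> B"
    by (rule w_bounded) blast
  define d where "d = min h (1 / (2 * L * B))"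
  have d: "0 < d" "d \<le> h" "d \<le> 1 / (2 * L * B)"
    using B L h_pos by (auto simp: d_def)
  have LBd: "L * (B * d) \<le> 1/2"
    using d(3) B(1) L by (simp add: field_simps)
  show thesis
  proof (rule that[of d "2 * L"])
    fix F x assume F: "antimono F" "\<And>y. 0 \<le> F y" "F x \<le> L * avg F x"
    have "((\<lambda>_. F x * B) has_integral (F x * B * d)) {0..d}"
      using has_integral_const_real[of "F x * B" 0 d] d(1) by (simp add: mult.commute)
    then have "((\<lambda>s. if s \<in> {0..d} then F x * B else 0) has_integral (F x * B * d)) {0..h}"
      using has_integral_restrict[of "{0..d}" "{0..h}" "\<lambda>_. F x * B"] d(2) by simp
    then have "((\<lambda>s. (if s \<in> {0..d} then F x * B else 0) + F (x + d) * w s)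
        has_integral (F x * B * d + F (x + d) * 1)) {0..h}"
      by (intro has_integral_add has_integral_mult_right w_integral)
    moreover have "((\<lambda>s. F (x + s) * w s) has_integral avg F x) {0..h}"
      using avg_integrable_antimono[OF F(1)] unfolding avg_def avg_integrable_def
      by (blast intro: integrable_integral)
    moreover have "F (x + s) * w s \<le> (if s \<in> {0..d} then F x * B else 0) + F (x + d) * w s"
      if s: "s \<in> {0..h}" for s
    proof (cases "s \<le> d")
      case True
      have "F (x + s) * w s \<le> F x * B"
        using B(2) w_nonneg F(2) antimonoD[OF F(1), of x "x + s"] s by (intro mult_mono) auto
      then show ?thesis
        using True s F(2)[of "x + d"] w_nonneg[of s] by (simp add: add_increasing2)
    next
      case False
      then show ?thesis
        using w_nonneg[of s] antimonoD[OF F(1), of "x + d" "x + s"] by (simp add: mult_right_mono)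
    qed
    ultimately have "avg F x \<le> F x * B * d + F (x + d) * 1"
      using has_integral_le by blast
    then have "L * avg F x \<le> L * (F x * B * d + F (x + d))"
      using L by (simp add: mult_left_mono)
    also have "\<dots> = F x * (L * (B * d)) + L * F (x + d)"
      by (simp add: algebra_simps)
    also have "\<dots> \<le> F x * (1/2) + L * F (x + d)"
      using LBd F(2)[of x] by (intro add_right_mono mult_left_mono) auto
    finally show "F x \<le> 2 * L * F (x + d)"
      using F(3) by simp
  qed (use L d in auto)
qed

section \<open>Decay profiles: compactness, multiplicativity and uniqueness\<close>

definition decay_profile :: "real \<Rightarrow> (real \<Rightarrow> real) \<Rightarrow> bool" where
  "decay_profile g U \<longleftrightarrow> continuous_on UNIV U \<and> antimono U \<and> (\<forall>x. 0 < U x) \<and>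
     (\<forall>x. U x = g * avg U x) \<and> U 0 = 1"

text \<open>Starting from the common value 1 at the origin, \<open>harnack\<close> is iterated to
  the left for upper bounds and to the right for positive lower bounds, and then Helly's theorem
  applies. The equation is assumed only asymptotically, so that both exact profiles and rescaled
  deficits are covered.\<close>

lemma decay_compactness:
  assumes cont: "\<And>n. continuous_on UNIV (f n)" and anti: "\<And>n. antimono (f n)"
    and pos: "\<And>n x. 0 < f n x" and at_0: "\<And>n. f n 0 = 1" and L: "0 < L"
    and bound: "\<And>Y. \<forall>\<^sub>F n in sequentially. \<forall>x\<ge>Y. f n x \<le> L * avg (f n) x"
    and ratio: "\<And>x. (\<lambda>n. f n x / avg (f n) x) \<longlonglongrightarrow> g"
  obtains s U where "strict_mono (s :: nat \<Rightarrow> nat)" "decay_profile g U"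
    "\<And>x. (\<lambda>n. f (s n) x) \<longlonglongrightarrow> U x"
proof -
  obtain d C where dC: "0 < d" "0 < C"
    and harnack: "\<And>F x. antimono F \<Longrightarrow> (\<And>y. 0 \<le> F y) \<Longrightarrow> F x \<le> L * avg F x \<Longrightarrow> F x \<le> C * F (x + d)"
    by (rule harnack[OF L]) blast
  have upper: "\<exists>K. \<forall>\<^sub>F n in sequentially. \<forall>y\<ge>x. f n y \<le> K" for x
  proof -
    obtain k :: nat where k: "- x \<le> real k * d"
      using reals_Archimedean3[OF dC(1)] by (meson less_imp_le)
    have "\<forall>\<^sub>F n in sequentially. \<forall>y\<ge>x. f n y \<le> C ^ k"
      using bound[of "- (real k * d)"]
    proof eventually_elim
      case (elim n)
      have "j \<le> k \<Longrightarrow> f n (- (real j * d)) \<le> C ^ j" for j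
      proof (induction j)
        case (Suc j)
        have "real (Suc j) * d \<le> real k * d"
          using Suc.prems dC(1) by (intro mult_right_mono) auto
        then have "f n (- (real (Suc j) * d)) \<le> C * f n (- (real (Suc j) * d) + d)"
          using elim less_imp_le[OF pos] by (intro harnack anti) auto
        also have "- (real (Suc j) * d) + d = - (real j * d)"
          by (simp add: algebra_simps)
        also have "C * f n (- (real j * d)) \<le> C * C ^ j"
          using Suc dC(2) by (intro mult_left_mono) auto
        finally show ?case by simp
      qed (simp add: at_0)
      then have "f n (- (real k * d)) \<le> C ^ k"
        by simp
      moreover have "f n y \<le> f n (- (real k * d))" if "y \<ge> x" for y
        using k that by (intro antimonoD[OF anti]) simp
      ultimately show ?case
        by (meson order_trans)
    qed
    then show ?thesis by blast
  qed
  have lower: "\<exists>c>0. \<forall>\<^sub>F n in sequentially. c \<le> f n x" for x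
  proof -
    obtain k :: nat where k: "x \<le> real k * d"
      using reals_Archimedean3[OF dC(1)] by (meson less_imp_le)
    have "\<forall>\<^sub>F n in sequentially. 1 / C ^ k \<le> f n x"
      using bound[of 0]
    proof eventually_elim
      case (elim n)
      have "1 \<le> C ^ j * f n (real j * d)" for j
      proof (induction j)
        case (Suc j)
        have "f n (real j * d) \<le> C * f n (real j * d + d)"
          using elim less_imp_le[OF pos] dC(1) by (intro harnack anti) auto
        then have "C ^ j * f n (real j * d) \<le> C ^ j * (C * f n (real j * d + d))"
          using dC(2) by (intro mult_left_mono) auto
        then show ?case
          using Suc.IH by (simp add: algebra_simps)
      qed (simp add: at_0)
      from this[of k] have "1 / C ^ k \<le> f n (real k * d)"
        using dC(2) by (simp add: field_simps)
      also have "\<dots> \<le> f n x"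
        using k antimonoD[OF anti[of n]] by blast
      finally show ?case .
    qed
    then show ?thesis
      using dC(2) by (intro exI[of _ "1 / C ^ k"]) auto
  qed
  have bdd: "Bseq (\<lambda>n. - f n x)" for x
  proof -
    obtain K where "\<forall>\<^sub>F n in sequentially. \<forall>y\<ge>x. f n y \<le> K"
      using upper by blast
    then have "\<forall>\<^sub>F n in sequentially. norm (- f n x) \<le> K"
      by eventually_elim (use pos in \<open>auto simp: less_imp_le\<close>)
    then show ?thesis
      by (rule BfunI)
  qed
  \<comment> \<open>Helly's theorem concerns increasing functions, hence the sign.\<close>
  obtain s H D where s: "strict_mono (s :: nat \<Rightarrow> nat)" and D: "countable D"
    and "\<And>x. x \<notin> D \<Longrightarrow> (\<lambda>n. - f (s n) x) \<longlonglongrightarrow> H x"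
  proof (rule helly_pointwise_bounded[of "\<lambda>n x. - f n x"])
    show "continuous_on UNIV (\<lambda>x. - f n x)" for n
      by (intro continuous_intros cont)
    show "mono (\<lambda>x. - f n x)" for n
      using anti[of n] by (simp add: monotone_def)
  qed (use bdd in blast)+
  then have H: "(\<lambda>n. f (s n) x) \<longlonglongrightarrow> - H x" if "x \<notin> D" for x
    using tendsto_minus[of "\<lambda>n. - f (s n) x" "H x"] that by simp
  have evs: "\<forall>\<^sub>F n in sequentially. P (s n)" if "\<forall>\<^sub>F n in sequentially. P n" for P
    using eventually_subseq[OF s that] .
  have avg_bdd: "\<exists>K. \<forall>\<^sub>F n in sequentially. \<forall>t\<in>{0..h}. \<bar>f (s n) (x + t)\<bar> \<le> K" for x
  proof -
    obtain K where "\<forall>\<^sub>F n in sequentially. \<forall>y\<ge>x. f n y \<le> K"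
      using upper by blast
    from evs[OF this] have "\<forall>\<^sub>F n in sequentially. \<forall>t\<in>{0..h}. \<bar>f (s n) (x + t)\<bar> \<le> K"
      by eventually_elim (use pos in \<open>auto simp: less_imp_le\<close>)
    then show ?thesis by blast
  qed
  have int: "avg_integrable (f n)" for n
    by (rule avg_integrable_continuous[OF cont])
  have avg_H: "(\<lambda>n. avg (f (s n)) x) \<longlonglongrightarrow> avg (\<lambda>y. - H y) x" for x
    using avg_bdd[of x] avg_tendsto(2)[OF int D H] by blast
  \<comment> \<open>The Helly limit is controlled only off \<open>D\<close>. Defining
    \<open>U\<close> through the equation selects the representative to which the sequence converges
    everywhere, because the averages converge everywhere.\<close>
  define U where "U x = g * avg (\<lambda>y. - H y) x" for x
  have U: "(\<lambda>n. f (s n) x) \<longlonglongrightarrow> U x" for x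
  proof -
    have "(\<lambda>n. f (s n) x / avg (f (s n)) x * avg (f (s n)) x) \<longlonglongrightarrow> U x"
      unfolding U_def
      by (intro tendsto_mult avg_H LIMSEQ_subseq_LIMSEQ[OF ratio s, unfolded o_def])
    moreover have "avg (f n) x > 0" for n
      using avg_pos[OF cont] pos by blast
    ultimately show ?thesis
      by (simp add: less_imp_neq[symmetric])
  qed
  have "(\<lambda>n. avg (f (s n)) x) \<longlonglongrightarrow> avg U x" for x
    using avg_bdd[of x] avg_tendsto(2)[OF int countable_empty U] by blast
  then have eq: "U x = g * avg U x" for x
    using LIMSEQ_unique[OF avg_H] unfolding U_def by metis
  have U_anti: "antimono U"
    by (intro antimonoI LIMSEQ_le[OF U U] exI[of _ 0] allI impI antimonoD[OF anti])
  have "mono (\<lambda>x. - U x)"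
    using U_anti by (auto simp: monotone_def)
  from avg_continuous[OF this] have "continuous_on UNIV (\<lambda>x. - g * - avg U x)"
    unfolding avg_minus by (rule continuous_on_mult_left)
  then have U_cont: "continuous_on UNIV U"
    using eq by simp
  have U_pos: "0 < U x" for x
  proof -
    obtain c where c: "c > 0" "\<forall>\<^sub>F n in sequentially. c \<le> f n x"
      using lower by blast
    have "c \<le> U x"
      by (rule tendsto_lowerbound[OF U evs[OF c(2)]]) simp
    then show ?thesis using c(1) by simp
  qed
  have "U 0 = 1"
    using U[of 0] by (simp add: at_0 LIMSEQ_const_iff)
  then show thesis
    using that[OF s _ U] U_anti U_cont U_pos eq unfolding decay_profile_def by blast
qed

lemma decay_profileD:
  assumes "decay_profile g U"
  shows "continuous_on UNIV U" "antimono U" "0 < U x" "U x = g * avg U x" "U 0 = 1"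
  using assms unfolding decay_profile_def by auto

text \<open>The equation is linear and invariant under translation, and dividing by
  \<open>U t\<close> restores the normalisation.\<close>

lemma decay_profile_translate:
  assumes U: "decay_profile g U"
  shows "decay_profile g (\<lambda>y. U (t + y) / U t)"
proof -
  note U' = decay_profileD[OF U]
  have "U (t + x) / U t = g * avg (\<lambda>y. U (t + y) / U t) x" for x
    using avg_cmult[of "1 / U t" "\<lambda>y. U (t + y)" x] U'(4)[of "t + x"] by (simp add: avg_shift)
  moreover have "continuous_on UNIV (\<lambda>y. U (t + y) / U t)"
    using U'(3)[of t] by (intro continuous_intros continuous_on_compose2[OF U'(1)]) auto
  moreover have "antimono (\<lambda>y. U (t + y) / U t)"
    using U'(3)[of t] by (intro antimonoI divide_right_mono antimonoD[OF U'(2)]) auto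
  moreover have "0 < U (t + x) / U t" for x
    by (intro divide_pos_pos U'(3))
  moreover have "U (t + 0) / U t = 1"
    using U'(3)[of t] by simp
  ultimately show ?thesis
    unfolding decay_profile_def by blast
qed

text \<open>Exact profiles satisfy the hypotheses of \<open>decay_compactness\<close> with
  \<open>L\<close> equal to \<open>g\<close>. The lemma guarantees that extremal growth is
  attained.\<close>

lemma decay_values_compact:
  assumes g: "0 < g"
  shows "compact {U x |U. decay_profile g U}"
  unfolding compact_eq_seq_compact_metric
proof (rule seq_compactI)
  fix f :: "nat \<Rightarrow> real" assume "\<forall>n. f n \<in> {U x |U. decay_profile g U}"
  then obtain V where V: "\<And>n. decay_profile g (V n)" and f: "\<And>n. f n = V n x"
    by simp metis
  note V' = decay_profileD[OF V]
  have "0 < avg (V n) y" for n y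
    using avg_pos[OF V'(1)] V'(3) by blast
  then have ratio: "V n y / avg (V n) y = g" for n y
    using V'(4)[of n y] by (metis less_irrefl nonzero_eq_divide_eq)
  obtain s U where "strict_mono (s :: nat \<Rightarrow> nat)" "decay_profile g U"
    "\<And>y. (\<lambda>n. V (s n) y) \<longlonglongrightarrow> U y"
    by (rule decay_compactness[of V g g])
      (use V' ratio g in \<open>auto intro!: eq_refl[OF V'(4)]\<close>)
  then show "\<exists>l\<in>{U x |U. decay_profile g U}. \<exists>r. strict_mono r \<and> (f \<circ> r) \<longlonglongrightarrow> l"
    unfolding o_def f by blast
qed

text \<open>A profile that maximises or minimises the growth over a step \<open>t\<close> among all profiles is
  multiplicative under that step: by translation the extremal inequality holds at every point, and
  there is equality at the origin.\<close>

lemma decay_extremal_multiplicative: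
  assumes g: "0 < g" and U: "decay_profile g U" and \<sigma>: "\<sigma> = 1 \<or> \<sigma> = (-1::real)"
    and ext: "\<And>V. decay_profile g V \<Longrightarrow> \<sigma> * V (- t) \<le> \<sigma> * U (- t)"
  shows "U (x - t) = U (- t) * U x"
proof -
  note U' = decay_profileD[OF U]
  \<comment> \<open>The sign is 1 for a maximiser and -1 for a minimiser, so that in both cases
    extremality says that \<open>F\<close> is nonnegative.\<close>
  define F where "F x = \<sigma> * (U (- t) * U x - U (- t + x))" for x
  have F_cont: "continuous_on UNIV F"
    unfolding F_def by (intro continuous_intros continuous_on_compose2[OF U'(1)]) auto
  have F_nonneg: "0 \<le> F x" for x
  proof -
    have "\<sigma> * (U (x + - t) / U x) * U x \<le> \<sigma> * U (- t) * U x"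
      using ext[OF decay_profile_translate[OF U, of x]] U'(3)[of x] by (intro mult_right_mono) auto
    then show ?thesis
      using U'(3)[of x] by (simp add: F_def algebra_simps)
  qed
  have int: "avg_integrable U"
    by (rule avg_integrable_continuous[OF U'(1)])
  have F_eq: "F x = g * avg F x" for x
  proof -
    have "avg F x = \<sigma> * (U (- t) * avg U x - avg U (- t + x))"
      unfolding F_def avg_cmult avg_diff[OF avg_integrable_cmult[OF int] avg_integrable_shift[OF int]]
        avg_shift ..
    then have "g * avg F x = \<sigma> * (U (- t) * (g * avg U x) - g * avg U (- t + x))"
      by (simp only:) (simp add: right_diff_distrib mult.left_commute)
    then show ?thesis
      unfolding F_def U'(4)[symmetric] by simp
  qed
  have "F x = 0"
  proof (rule vanishing_propagates[OF F_cont g F_nonneg, where ?x0.0 = 0])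
    show "avg F y = 0" if "F y = 0" for y
      using F_eq[of y] g that by simp
    show "F 0 = 0"
      using U'(5) by (simp add: F_def)
  qed (simp add: F_eq[symmetric])
  then show ?thesis
    using \<sigma> by (auto simp: F_def)
qed

text \<open>On the window from 0 to \<open>h\<close>, \<open>U\<close> is at most 1 and hence at
  most \<open>V / V h\<close>. Backward comparison extends this bound to the left, where
  \<open>U\<close> and \<open>V\<close> grow like the powers of \<beta> and \<alpha>; a larger
  \<beta> would violate it after enough steps.\<close>

lemma decay_rate_le:
  assumes g: "0 < g" and U: "decay_profile g U" and V: "decay_profile g V" and t: "0 \<le> t"
    and mU: "\<And>x. U (x - t) = \<beta> * U x" and mV: "\<And>x. V (x - t) = \<alpha> * V x"
  shows "\<beta> \<le> \<alpha>"
proof (rule ccontr)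
  assume "\<not> ?thesis"
  then have less: "\<alpha> < \<beta>" by simp
  note U' = decay_profileD[OF U] and V' = decay_profileD[OF V]
  have "\<alpha> > 0"
    using mV[of 0] V'(3)[of "- t"] V'(5) by simp
  define K where "K = 1 / V h"
  have K: "0 < K"
    using V'(3)[of h] by (simp add: K_def)
  have le: "U x - K * V x \<le> 0" if "x \<le> 0 + h" for x
  proof (rule backward_comparison[OF _ g _ _ that, where F = "\<lambda>x. U x - K * V x"])
    show "continuous_on UNIV (\<lambda>x. U x - K * V x)"
      by (intro continuous_intros U'(1) V'(1))
    show "U x - K * V x \<le> g * avg (\<lambda>x. U x - K * V x) x" for x
      using U'(4)[of x] V'(4)[of x]
      unfolding avg_diff[OF avg_integrable_continuous[OF U'(1)]
          avg_integrable_cmult[OF avg_integrable_continuous[OF V'(1)]]] avg_cmult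
      by (simp add: right_diff_distrib mult.left_commute)
    show "U y - K * V y \<le> 0" if "y \<in> {0..0 + h}" for y
    proof -
      have "U y \<le> 1"
        using antimonoD[OF U'(2), of 0 y] that U'(5) by simp
      also have "1 = K * V h"
        using V'(3)[of h] by (simp add: K_def)
      also have "\<dots> \<le> K * V y"
        using that K by (intro mult_left_mono antimonoD[OF V'(2)]) auto
      finally show ?thesis by simp
    qed
  qed
  have pow: "U (- (real k * t)) = \<beta> ^ k" "V (- (real k * t)) = \<alpha> ^ k" for k
  proof (induction k)
    case (Suc k)
    have "- (real (Suc k) * t) = - (real k * t) - t"
      by (simp add: algebra_simps)
    then show "U (- (real (Suc k) * t)) = \<beta> ^ Suc k" "V (- (real (Suc k) * t)) = \<alpha> ^ Suc k"
      using Suc mU mV by auto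
  qed (use U'(5) V'(5) in auto)
  obtain k where k: "K < (\<beta> / \<alpha>) ^ k"
    using real_arch_pow[of "\<beta> / \<alpha>" K] less \<open>\<alpha> > 0\<close> by auto
  have "0 \<le> real k * t"
    using t by simp
  then have "- (real k * t) \<le> 0 + h"
    using h_pos by linarith
  from le[OF this] have "\<beta> ^ k \<le> K * \<alpha> ^ k"
    using pow[of k] by simp
  then have "(\<beta> / \<alpha>) ^ k \<le> K"
    using \<open>\<alpha> > 0\<close> by (simp add: power_divide divide_le_eq)
  then show False
    using k by simp
qed

text \<open>The profiles with the largest and the smallest value at \<open>- t\<close> are both
  multiplicative under the step, so \<open>decay_rate_le\<close> makes these values equal and leaves
  no room for any other profile.\<close>

lemma decay_profile_unique:
  assumes g: "0 < g" and U: "decay_profile g U" and V: "decay_profile g V"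
  shows "U = V"
proof -
  have neg: "U (- t) = V (- t)" if t: "0 \<le> t" and U: "decay_profile g U" and V: "decay_profile g V" for t U V
  proof -
    let ?S = "{U (- t) |U. decay_profile g U}"
    have ne: "?S \<noteq> {}"
      using U by blast
    obtain A where A: "decay_profile g A" "\<And>V. decay_profile g V \<Longrightarrow> V (- t) \<le> A (- t)"
      using compact_attains_sup[OF decay_values_compact[OF g, of "- t"] ne] by blast
    obtain B where B: "decay_profile g B" "\<And>V. decay_profile g V \<Longrightarrow> B (- t) \<le> V (- t)"
      using compact_attains_inf[OF decay_values_compact[OF g, of "- t"] ne] by blast
    have "A (- t) \<le> B (- t)"
    proof (rule decay_rate_le[OF g A(1) B(1) t])
      show "A (x - t) = A (- t) * A x" for x
        by (rule decay_extremal_multiplicative[OF g A(1), of 1]) (use A(2) in auto)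
      show "B (x - t) = B (- t) * B x" for x
        by (rule decay_extremal_multiplicative[OF g B(1), of "-1"]) (use B(2) in auto)
    qed
    then show ?thesis
      using A(2)[OF U] A(2)[OF V] B(2)[OF U] B(2)[OF V] by linarith
  qed
  have "U x = V x" for x
  proof (cases "x \<le> 0")
    case True
    then show ?thesis
      using neg[of "- x", OF _ U V] by simp
  next
    case False
    \<comment> \<open>Positive points are reached by evaluating the profiles translated by
      \<open>x\<close> at \<open>- x\<close>.\<close>
    then have "U 0 / U x = V 0 / V x"
      using neg[of x, OF _ decay_profile_translate[OF U, of x] decay_profile_translate[OF V, of x]]
      by simp
    then show ?thesis
      using decay_profileD(3,5)[OF U] decay_profileD(3,5)[OF V] by simp
  qed
  then show ?thesis by blast
qed

text \<open>By uniqueness each normalised translate is \<open>U\<close> itself, so \<open>U\<close>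
  turns sums into products. A value 1 at a positive point would then recur arbitrarily far to the
  right, keep \<open>U\<close> at least 1 on the whole window, and contradict \<open>g > 1\<close>
  at the origin.\<close>

lemma decay_profile_strict:
  assumes g: "1 < g" and U: "decay_profile g U" and "x < y"
  shows "U y < U x"
proof -
  note U' = decay_profileD[OF U]
  have mult: "U (a + b) = U a * U b" for a b
    using fun_cong[OF decay_profile_unique[OF _ decay_profile_translate[OF U, of a] U], of b] g U'(3)[of a]
    by (simp add: field_simps)
  have "U (y - x) < 1"
  proof (rule ccontr)
    assume "\<not> ?thesis"
    then have 1: "U (y - x) = 1"
      using antimonoD[OF U'(2), of 0 "y - x"] U'(5) \<open>x < y\<close> by simp
    have pow: "U (real k * (y - x)) = 1" for k
      by (induction k) (use U'(5) 1 mult in \<open>auto simp: distrib_right\<close>)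
    obtain k :: nat where "h \<le> real k * (y - x)"
      using reals_Archimedean3[of "y - x"] \<open>x < y\<close> by (meson less_imp_le diff_gt_0_iff_gt)
    then have "1 \<le> U s" if "s \<in> {0..h}" for s
      using pow[of k] antimonoD[OF U'(2), of s "real k * (y - x)"] that by simp
    then have "1 \<le> avg U 0"
      using avg_le[OF avg_integrable_const avg_integrable_continuous[OF U'(1)], of 1 0 0]
      by (simp add: avg_const)
    then show False
      using U'(4)[of 0] U'(5) g mult_left_mono[of 1 "avg U 0" g] by simp
  qed
  then have "U x * U (y - x) < U x * 1"
    using U'(3)[of x] by (intro mult_strict_left_mono) auto
  then show ?thesis
    using mult[of x "y - x"] by simp
qed

end

section \<open>Velocity, flux and the fixed-point equation\<close>

locale stationary_limits = averaging +
  fixes v :: "real \<Rightarrow> real" and \<rho>h \<rho>m \<rho>p :: real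
  assumes velocity: "velocity_function v" and stagnation: "stagnation_point v \<rho>h"
    and \<rho>m_pos: "0 < \<rho>m" and \<rho>m_less: "\<rho>m < \<rho>h" and less_\<rho>p: "\<rho>h < \<rho>p" and \<rho>p_less: "\<rho>p < 1"
    and flux_eq: "flux v \<rho>m = flux v \<rho>p"
begin

abbreviation c :: real where "c \<equiv> flux v \<rho>p"

lemma v_deriv:
  obtains v' where "\<And>\<rho>. \<rho> \<in> {0..1} \<Longrightarrow> (v has_real_derivative v' \<rho>) (at \<rho> within {0..1})"
    "\<And>\<rho>. \<rho> \<in> {0..1} \<Longrightarrow> v' \<rho> < 0" "continuous_on {0..1} v'"
proof -
  from velocity obtain v' v'' where *: 
    "\<And>\<rho>. \<rho> \<in> {0..1} \<Longrightarrow> (v has_real_derivative v' \<rho>) (at \<rho> within {0..1})"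
    "\<And>\<rho>. \<rho> \<in> {0..1} \<Longrightarrow> (v' has_real_derivative v'' \<rho>) (at \<rho> within {0..1})"
    "\<And>\<rho>. \<rho> \<in> {0..1} \<Longrightarrow> v' \<rho> < 0"
    unfolding velocity_function_def by metis
  from DERIV_continuous_on[OF *(2)] have "continuous_on {0..1} v'" .
  with * show thesis
    using that by blast
qed

lemma v_cont: "continuous_on {0..1} v"
  by (rule v_deriv) (rule DERIV_continuous_on)

lemma v_less:
  assumes "0 \<le> a" "a < b" "b \<le> 1"
  shows "v b < v a"
proof (rule v_deriv)
  fix v' assume *: "\<And>\<rho>. \<rho> \<in> {0..1} \<Longrightarrow> (v has_real_derivative v' \<rho>) (at \<rho> within {0..1})"
    "\<And>\<rho>. \<rho> \<in> {0..1} \<Longrightarrow> v' \<rho> < 0"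
  obtain z where "a < z" "z < b" "v b - v a = (b - a) * v' z"
    using mvt_unit_interval[OF assms *(1)] by blast
  moreover from this have "(b - a) * v' z < 0"
    using assms *(2)[of z] by (intro mult_pos_neg) auto
  ultimately show ?thesis by simp
qed

lemma v_le: "0 \<le> a \<Longrightarrow> a \<le> b \<Longrightarrow> b \<le> 1 \<Longrightarrow> v b \<le> v a"
  using v_less[of a b] by (cases "a = b") auto

lemma v_pos: "0 \<le> a \<Longrightarrow> a < 1 \<Longrightarrow> 0 < v a"
  using v_less[of a 1] velocity unfolding velocity_function_def by simp

lemma v_lipschitz:
  obtains K where "0 < K" "\<And>a b. 0 \<le> a \<Longrightarrow> a \<le> b \<Longrightarrow> b \<le> 1 \<Longrightarrow> v a - v b \<le> K * (b - a)"
proof (rule v_deriv)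
  fix v' assume *: "\<And>\<rho>. \<rho> \<in> {0..1} \<Longrightarrow> (v has_real_derivative v' \<rho>) (at \<rho> within {0..1})"
    "continuous_on {0..1} v'"
  have "compact (v' ` {0..1})"
    by (intro compact_continuous_image *) auto
  then obtain K where K: "\<And>\<rho>. \<rho> \<in> {0..1} \<Longrightarrow> \<bar>v' \<rho>\<bar> \<le> K"
    by (metis bounded_iff compact_imp_bounded imageI real_norm_def)
  show thesis
  proof (rule that[of "max K 1"])
    fix a b :: real assume ab: "0 \<le> a" "a \<le> b" "b \<le> 1"
    show "v a - v b \<le> max K 1 * (b - a)"
    proof (cases "a < b")
      case True
      then obtain z where z: "a < z" "z < b" "v b - v a = (b - a) * v' z"
        using mvt_unit_interval[OF ab(1) True ab(3) *(1)] by blast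
      then have "v a - v b = (- v' z) * (b - a)"
        by (simp add: algebra_simps)
      also have "\<dots> \<le> max K 1 * (b - a)"
        using K[of z] z ab by (intro mult_right_mono) auto
      finally show ?thesis .
    qed (use ab in auto)
  qed auto
qed

lemma isCont_v: "0 < a \<Longrightarrow> a < 1 \<Longrightarrow> isCont v a"
  using continuous_on_interior[OF v_cont] by simp

lemma c_pos: "0 < c"
  using v_pos[of \<rho>p] \<rho>m_pos \<rho>m_less less_\<rho>p \<rho>p_less by (simp add: flux_def)

lemma flux_deriv:
  obtains f' where "\<And>\<rho>. \<rho> \<in> {0..1} \<Longrightarrow> (flux v has_real_derivative f' \<rho>) (at \<rho> within {0..1})"
    "\<And>\<rho>. 0 \<le> \<rho> \<Longrightarrow> \<rho> < \<rho>h \<Longrightarrow> f' \<rho> > 0" "\<And>\<rho>. \<rho>h < \<rho> \<Longrightarrow> \<rho> \<le> 1 \<Longrightarrow> f' \<rho> < 0"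
  using stagnation unfolding stagnation_point_def by fastforce

lemma flux_right_unique:
  assumes "\<rho>h \<le> q" "q \<le> \<rho>p" "flux v q = c"
  shows "q = \<rho>p"
proof (rule flux_deriv, rule ccontr)
  fix f' assume *: "\<And>\<rho>. \<rho> \<in> {0..1} \<Longrightarrow> (flux v has_real_derivative f' \<rho>) (at \<rho> within {0..1})"
    "\<And>\<rho>. \<rho>h < \<rho> \<Longrightarrow> \<rho> \<le> 1 \<Longrightarrow> f' \<rho> < 0" and ne: "q \<noteq> \<rho>p"
  have q: "0 \<le> q" "q < \<rho>p" "\<rho>p \<le> 1"
    using assms ne \<rho>m_pos \<rho>m_less \<rho>p_less by auto
  obtain z where "q < z" "z < \<rho>p" "flux v \<rho>p - flux v q = (\<rho>p - q) * f' z"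
    using mvt_unit_interval[OF q *(1)] by blast
  then show False
    using *(2)[of z] assms \<rho>p_less by auto
qed

lemma flux_left_unique:
  assumes "\<rho>m \<le> q" "q \<le> \<rho>h" "flux v q = c"
  shows "q = \<rho>m"
proof (rule flux_deriv, rule ccontr)
  fix f' assume *: "\<And>\<rho>. \<rho> \<in> {0..1} \<Longrightarrow> (flux v has_real_derivative f' \<rho>) (at \<rho> within {0..1})"
    "\<And>\<rho>. 0 \<le> \<rho> \<Longrightarrow> \<rho> < \<rho>h \<Longrightarrow> f' \<rho> > 0" and ne: "q \<noteq> \<rho>m"
  have q: "0 \<le> \<rho>m" "\<rho>m < q" "q \<le> 1"
    using assms ne \<rho>m_pos less_\<rho>p \<rho>p_less by auto
  obtain z where "\<rho>m < z" "z < q" "flux v q - flux v \<rho>m = (q - \<rho>m) * f' z"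
    using mvt_unit_interval[OF q *(1)] by blast
  then show False
    using *(2)[of z] assms \<rho>m_pos flux_eq by auto
qed

text \<open>A solution of \<open>Q = c / v (W Q)\<close> whose deficit \<open>\<rho>p - Q\<close> has average \<open>a\<close> at a point has the deficit
  \<open>amplification a * a\<close> there.\<close>

definition amplification :: "real \<Rightarrow> real" where
  "amplification a = (\<rho>p - c / v (\<rho>p - a)) / a"

text \<open>The derivative at 0 of the map from averaged deficit to deficit, simplified by means of
  \<open>c = \<rho>p * v \<rho>p\<close>.\<close>

definition gain :: real where
  "gain = - \<rho>p * deriv v \<rho>p / v \<rho>p"

text \<open>That the gain exceeds 1 is a restatement of the flux having negative derivative at
  \<rho>p.\<close>

lemma amplification_tendsto: "(amplification \<longlongrightarrow> gain) (at_right 0)"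
  and gain_gt_1: "1 < gain"
proof (atomize (full), rule v_deriv)
  fix v' assume v': "\<And>\<rho>. \<rho> \<in> {0..1} \<Longrightarrow> (v has_real_derivative v' \<rho>) (at \<rho> within {0..1})"
  have p: "0 < \<rho>p" "\<rho>p \<in> {0..1}" "\<rho>p \<in> interior {0..1}"
    using \<rho>m_pos \<rho>m_less less_\<rho>p \<rho>p_less by auto
  have vp: "0 < v \<rho>p"
    using v_pos p \<rho>p_less by simp
  have dv: "(v has_real_derivative v' \<rho>p) (at \<rho>p)"
    using v'[OF p(2)] at_within_interior[OF p(3)] by simp
  have gain: "gain = - \<rho>p * v' \<rho>p / v \<rho>p"
    unfolding gain_def DERIV_imp_deriv[OF dv] ..
  have "1 < gain"
  proof (rule flux_deriv)
    fix f' assume f': "\<And>\<rho>. \<rho> \<in> {0..1} \<Longrightarrow> (flux v has_real_derivative f' \<rho>) (at \<rho> within {0..1})"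
      "\<And>\<rho>. \<rho>h < \<rho> \<Longrightarrow> \<rho> \<le> 1 \<Longrightarrow> f' \<rho> < 0"
    have "(flux v has_real_derivative f' \<rho>p) (at \<rho>p)"
      using f'(1)[OF p(2)] at_within_interior[OF p(3)] by simp
    moreover have "(flux v has_real_derivative (1 * v \<rho>p + v' \<rho>p * \<rho>p)) (at \<rho>p)"
      unfolding flux_def[abs_def] by (intro DERIV_mult DERIV_ident dv)
    ultimately have "v \<rho>p + v' \<rho>p * \<rho>p < 0"
      using DERIV_unique f'(2)[OF less_\<rho>p] \<rho>p_less by fastforce
    then show "1 < gain"
      using vp by (simp add: gain field_simps)
  qed
  moreover have "(amplification \<longlongrightarrow> gain) (at_right 0)"
  proof -
    \<comment> \<open>This map vanishes at 0, so its difference quotient there is exactly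
      \<open>amplification\<close>.\<close>
    have "((\<lambda>a. \<rho>p - c / v (\<rho>p - a)) has_real_derivative gain) (at 0)"
      using dv vp
      by (auto intro!: derivative_eq_intros DERIV_chain2[of v] simp: gain flux_def field_simps power2_eq_square)
    then have "((\<lambda>a. (\<rho>p - c / v (\<rho>p - a)) / a) \<longlongrightarrow> gain) (at 0)"
      using vp unfolding DERIV_def by (simp add: flux_def)
    then show ?thesis
      unfolding amplification_def[abs_def] by (rule filterlim_mono) (auto simp: at_le)
  qed
  ultimately show "(amplification \<longlongrightarrow> gain) (at_right 0) \<and> 1 < gain"
    by blast
qed

text \<open>Limits at infinity and normalisation are left out: translates stay in the class, and the
  limit of the discrete profiles can be placed in it before its behaviour at infinity is
  known.\<close>

definition solution :: "(real \<Rightarrow> real) \<Rightarrow> bool" where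
  "solution Q \<longleftrightarrow> continuous_on UNIV Q \<and> mono Q \<and> (\<forall>x. \<rho>m \<le> Q x \<and> Q x \<le> \<rho>p) \<and>
     (\<forall>x. Q x = c / v (avg Q x))"

definition profile :: "(real \<Rightarrow> real) \<Rightarrow> bool" where
  "profile Q \<longleftrightarrow> stationary_profile h w v Q \<and> normalised_between \<rho>m \<rho>p \<rho>h Q"

lemma solutionD:
  assumes "solution Q"
  shows "continuous_on UNIV Q" "mono Q" "\<rho>m \<le> Q x" "Q x \<le> \<rho>p" "Q x = c / v (avg Q x)"
    "avg_integrable Q" "\<rho>m \<le> avg Q x" "avg Q x \<le> \<rho>p"
proof -
  show *: "continuous_on UNIV Q" "mono Q" "\<rho>m \<le> Q x" "Q x \<le> \<rho>p" "Q x = c / v (avg Q x)" for x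
    using assms unfolding solution_def by auto
  show int: "avg_integrable Q"
    by (rule avg_integrable_mono[OF *(2)])
  show "\<rho>m \<le> avg Q x" "avg Q x \<le> \<rho>p"
    using avg_bounds[OF int] * by blast+
qed

lemma solution_shift:
  assumes "solution Q"
  shows "solution (\<lambda>x. Q (t + x))"
proof -
  note Q = solutionD[OF assms]
  have "continuous_on UNIV (\<lambda>x. Q (t + x))"
    by (intro continuous_intros continuous_on_compose2[OF Q(1)]) auto
  moreover have "mono (\<lambda>x. Q (t + x))"
    by (intro monoI monoD[OF Q(2)]) auto
  ultimately show ?thesis
    unfolding solution_def avg_shift using Q(3,4,5) by blast
qed

lemma mono_avg_squeeze:
  assumes "mono Q"
  shows "Q x \<le> avg Q x" "avg Q x \<le> Q (x + h)"
  using avg_bounds[OF avg_integrable_mono[OF assms], where x = x and a = "Q x" and b = "Q (x + h)"]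
    monoD[OF assms] by auto

lemma mono_avg_tendsto_at_top:
  assumes "mono Q" and lim: "(Q \<longlongrightarrow> q) at_top"
  shows "(avg Q \<longlongrightarrow> q) at_top"
proof -
  have "filterlim (\<lambda>x. x + h) at_top at_top"
    by (rule filterlim_at_top_mono[OF filterlim_ident]) (use h_pos in auto)
  from filterlim_compose[OF lim this] have "((\<lambda>x. Q (x + h)) \<longlongrightarrow> q) at_top" .
  from tendsto_sandwich[OF _ _ lim this] show ?thesis
    by (simp add: mono_avg_squeeze[OF assms(1)])
qed

lemma profile_solution:
  assumes "profile Q"
  shows "solution Q" "(Q \<longlongrightarrow> \<rho>m) at_bot" "(Q \<longlongrightarrow> \<rho>p) at_top" "Q 0 = \<rho>h"
proof -
  show lim: "(Q \<longlongrightarrow> \<rho>m) at_bot" "(Q \<longlongrightarrow> \<rho>p) at_top" "Q 0 = \<rho>h"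
    using assms unfolding profile_def normalised_between_def by auto
  from assms obtain k where Q: "continuous_on UNIV Q" "mono Q" "\<And>x. 0 < Q x \<and> Q x < 1"
    and k: "\<And>x. Q x * v (avg Q x) = k"
    unfolding profile_def stationary_profile_def avg_def by auto
  have low: "\<rho>m \<le> Q x" for x
    by (rule tendsto_upperbound[OF lim(1)])
      (auto intro!: eventually_mono[OF eventually_le_at_bot[of x]] monoD[OF Q(2)])
  have high: "Q x \<le> \<rho>p" for x
    by (rule tendsto_lowerbound[OF lim(2)])
      (auto intro!: eventually_mono[OF eventually_ge_at_top[of x]] monoD[OF Q(2)])
  \<comment> \<open>The constant flux of the profile is identified as \<open>c\<close> by its limit
    at plus infinity.\<close>
  have "(avg Q \<longlongrightarrow> \<rho>p) at_top"
    by (rule mono_avg_tendsto_at_top[OF Q(2) lim(2)])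
  moreover have "isCont v \<rho>p"
    using isCont_v \<rho>m_pos \<rho>m_less less_\<rho>p \<rho>p_less by simp
  ultimately have "((\<lambda>x. Q x * v (avg Q x)) \<longlongrightarrow> \<rho>p * v \<rho>p) at_top"
    by (intro tendsto_mult lim isCont_tendsto_compose[of _ v])
  then have kc: "k = c"
    unfolding k by (simp add: flux_def tendsto_const_iff)
  have vpos: "0 < v (avg Q x)" for x
  proof -
    have "\<rho>m \<le> avg Q x" "avg Q x \<le> \<rho>p"
      using avg_bounds[OF avg_integrable_mono[OF Q(2)]] low high by blast+
    then show ?thesis
      using \<rho>m_pos \<rho>p_less by (intro v_pos) auto
  qed
  have "Q x = c / v (avg Q x)" for x
  proof -
    have "v (avg Q x) \<noteq> 0"
      using vpos[of x] by simp
    then show ?thesis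
      using k[of x] kc by (intro nonzero_eq_divide_eq[THEN iffD2]) auto
  qed
  then show "solution Q"
    unfolding solution_def using Q low high by blast
qed

text \<open>Since \<open>v\<close> decreases, the order of the values at \<open>x\<close> is also
  the order of the averages. The Lipschitz bound for \<open>v\<close>, with the denominators bounded
  below by \<open>v \<rho>p\<close>, then gives a linear inequality, which admits the nonlinear
  equation to the linear comparison lemmas.\<close>

lemma solution_difference_le:
  obtains L where "0 < L" "\<And>Q R x. solution Q \<Longrightarrow> solution R \<Longrightarrow> R x \<le> Q x \<Longrightarrow>
    Q x - R x \<le> L * avg (\<lambda>y. Q y - R y) x"
proof (rule v_lipschitz)
  fix K assume K: "0 < K" "\<And>a b. 0 \<le> a \<Longrightarrow> a \<le> b \<Longrightarrow> b \<le> 1 \<Longrightarrow> v a - v b \<le> K * (b - a)"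
  have vp: "0 < v \<rho>p"
    using v_pos \<rho>m_pos \<rho>m_less less_\<rho>p \<rho>p_less by simp
  show thesis
  proof (rule that[of "c * K / (v \<rho>p)\<^sup>2"])
    show "0 < c * K / (v \<rho>p)\<^sup>2"
      using K(1) c_pos vp by simp
    fix Q R x assume QR: "solution Q" "solution R" "R x \<le> Q x"
    note Q = solutionD[OF QR(1)] and R = solutionD[OF QR(2)]
    have vpos: "v \<rho>p \<le> v (avg Q x)" "v \<rho>p \<le> v (avg R x)"
      using Q(7,8)[of x] R(7,8)[of x] \<rho>m_pos \<rho>p_less by (auto intro!: v_le)
    then have vpos': "0 < v (avg Q x)" "0 < v (avg R x)"
      using vp by auto
    have "v (avg Q x) \<le> v (avg R x)"
    proof -
      have "c / v (avg R x) \<le> c / v (avg Q x)"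
        using QR(3) Q(5)[of x] R(5)[of x] by simp
      then show ?thesis
        using c_pos vpos' by (simp add: field_simps)
    qed
    then have "avg R x \<le> avg Q x"
      using v_less[of "avg Q x" "avg R x"] Q(7)[of x] R(8)[of x] \<rho>m_pos \<rho>p_less by fastforce
    then have K': "v (avg R x) - v (avg Q x) \<le> K * (avg Q x - avg R x)" "0 \<le> K * (avg Q x - avg R x)"
      using K(1) K(2)[of "avg R x" "avg Q x"] R(7)[of x] Q(8)[of x] \<rho>m_pos \<rho>p_less by auto
    have "Q x - R x = c / v (avg Q x) - c / v (avg R x)"
      using Q(5)[of x] R(5)[of x] by simp
    also have "\<dots> = c * ((v (avg R x) - v (avg Q x)) / (v (avg Q x) * v (avg R x)))"
      using vpos' by (simp add: field_simps)
    also have "\<dots> \<le> c * (K * (avg Q x - avg R x) / (v \<rho>p * v \<rho>p))"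
      using K' c_pos vpos vpos' vp by (intro mult_left_mono frac_le mult_mono) auto
    also have "\<dots> = c * K / (v \<rho>p)\<^sup>2 * avg (\<lambda>y. Q y - R y) x"
      unfolding avg_diff[OF Q(6) R(6)] by (simp add: power2_eq_square)
    finally show "Q x - R x \<le> c * K / (v \<rho>p)\<^sup>2 * avg (\<lambda>y. Q y - R y) x" .
  qed
qed

lemma solution_eq_imp_avg_eq:
  assumes "solution Q" "solution R" "Q x = R x"
  shows "avg Q x = avg R x"
proof -
  note Q = solutionD[OF assms(1)] and R = solutionD[OF assms(2)]
  have pos: "0 < v (avg Q x)" "0 < v (avg R x)"
    using Q(7,8)[of x] R(7,8)[of x] \<rho>m_pos \<rho>p_less by (auto intro!: v_pos)
  have "c / v (avg Q x) = c / v (avg R x)"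
    using assms(3) unfolding Q(5)[of x] R(5)[of x] .
  then have "v (avg Q x) = v (avg R x)"
    using pos c_pos by auto
  then show ?thesis
    using v_less[of "avg Q x" "avg R x"] v_less[of "avg R x" "avg Q x"]
      Q(7,8)[of x] R(7,8)[of x] \<rho>m_pos \<rho>p_less by fastforce
qed

lemma solution_le_backward:
  assumes "solution Q" "solution R" "\<And>y. y \<in> {x0..x0 + h} \<Longrightarrow> Q y \<le> R y" "x \<le> x0 + h"
  shows "Q x \<le> R x"
proof (rule solution_difference_le)
  fix L assume L: "0 < L" "\<And>Q R x. solution Q \<Longrightarrow> solution R \<Longrightarrow> R x \<le> Q x \<Longrightarrow>
    Q x - R x \<le> L * avg (\<lambda>y. Q y - R y) x"
  have "Q x - R x \<le> 0"
    by (rule backward_comparison[where F = "\<lambda>y. Q y - R y", OF _ L(1) L(2) _ assms(4)])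
      (use assms solutionD(1) in \<open>auto intro!: continuous_intros\<close>)
  then show ?thesis by simp
qed

text \<open>A strong maximum principle: where the nonnegative difference vanishes, injectivity of
  \<open>v\<close> makes its average vanish too, so that zeros propagate.\<close>

lemma solution_touching:
  assumes "solution Q" "solution R" "\<And>y. R y \<le> Q y" "Q x0 = R x0"
  shows "Q x = R x"
proof (rule solution_difference_le)
  fix L assume L: "0 < L" "\<And>Q R x. solution Q \<Longrightarrow> solution R \<Longrightarrow> R x \<le> Q x \<Longrightarrow>
    Q x - R x \<le> L * avg (\<lambda>y. Q y - R y) x"
  have "Q x - R x = 0"
  proof (rule vanishing_propagates[where F = "\<lambda>y. Q y - R y" and L = L and ?x0.0 = x0])
    show "avg (\<lambda>y. Q y - R y) y = 0" if "Q y - R y = 0" for y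
      using solution_eq_imp_avg_eq[OF assms(1,2), of y] that
        avg_diff[OF solutionD(6)[OF assms(1)] solutionD(6)[OF assms(2)], of y] by simp
  qed (use assms L solutionD(1) in \<open>auto intro!: continuous_intros\<close>)
  then show ?thesis by simp
qed

text \<open>A flat piece makes a translate touch the profile from above, so the two coincide and the
  profile is periodic. The value \<rho>h would then recur at arbitrarily large points, against the
  limit \<rho>p.\<close>

lemma profile_strict:
  assumes Q: "profile Q" and "x < y"
  shows "Q x < Q y"
proof (rule ccontr)
  note Q' = profile_solution[OF Q] and mono = solutionD(2)[OF profile_solution(1)[OF Q]]
  assume "\<not> ?thesis"
  then have eq: "Q (y - x + x) = Q x"
    using monoD[OF mono, of x y] \<open>x < y\<close> by simp
  have per: "Q (y - x + z) = Q z" for z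
    by (rule solution_touching[OF solution_shift[OF Q'(1)] Q'(1) _ eq])
      (use monoD[OF mono] \<open>x < y\<close> in auto)
  have "Q (real n * (y - x)) = \<rho>h" for n
  proof (induction n)
    case (Suc n)
    then show ?case
      using per[of "real n * (y - x)"] by (simp add: distrib_right add.commute)
  qed (use Q'(4) in simp)
  moreover have "filterlim (\<lambda>n. real n * (y - x)) at_top sequentially"
    using \<open>x < y\<close> by (intro filterlim_at_top_mult_tendsto_pos[OF tendsto_const] filterlim_real_sequentially) auto
  from filterlim_compose[OF Q'(3) this] have "(\<lambda>n. Q (real n * (y - x))) \<longlonglongrightarrow> \<rho>p" .
  ultimately show False
    using less_\<rho>p by (simp add: LIMSEQ_const_iff)
qed

section \<open>Uniqueness of the stationary profile\<close>

text \<open>The averaged deficit tends to 0 through positive values, so the ratio is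
  \<open>amplification\<close> along a path into 0 from the right.\<close>

lemma deficit:
  assumes "profile Q"
  defines "u \<equiv> \<lambda>x. \<rho>p - Q x"
  shows "continuous_on UNIV u" "antimono u" "0 < u x"
    "((\<lambda>x. u x / avg u x) \<longlongrightarrow> gain) at_top"
proof -
  note Q = profile_solution[OF assms(1)]
  note Q' = solutionD[OF Q(1)]
  show "continuous_on UNIV u"
    unfolding u_def by (intro continuous_intros Q'(1))
  show "antimono u"
    unfolding u_def by (intro antimonoI diff_left_mono monoD[OF Q'(2)])
  show pos: "0 < u x" for x
    using profile_strict[OF assms(1), of x "x + 1"] Q'(4)[of "x + 1"] by (simp add: u_def)
  have "(u \<longlongrightarrow> \<rho>p - \<rho>p) at_top"
    unfolding u_def by (intro tendsto_intros Q(3))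
  then have lim: "(u \<longlongrightarrow> 0) at_top"
    by simp
  have avg_u: "avg u x = \<rho>p - avg Q x" for x
    unfolding u_def avg_diff[OF avg_integrable_const Q'(6)] avg_const ..
  have avg_u_pos: "0 < avg u x" for x
    unfolding avg_u using mono_avg_squeeze(2)[OF Q'(2), of x] pos[of "x + h"] by (simp add: u_def)
  moreover have "avg u x \<le> u x" for x
    unfolding avg_u using mono_avg_squeeze(1)[OF Q'(2), of x] by (simp add: u_def)
  ultimately have "(avg u \<longlongrightarrow> 0) at_top"
    by (intro tendsto_sandwich[OF _ _ tendsto_const lim]) (auto simp: less_imp_le)
  then have "filterlim (avg u) (at_right 0) at_top"
    using avg_u_pos avg_u_pos[THEN less_imp_neq, symmetric] by (auto simp: filterlim_at)
  from filterlim_compose[OF amplification_tendsto this]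
  have "((\<lambda>x. amplification (avg u x)) \<longlongrightarrow> gain) at_top" .
  moreover have "amplification (avg u x) = u x / avg u x" for x
  proof -
    have "\<rho>p - c / v (\<rho>p - avg u x) = u x"
      unfolding avg_u using Q'(5)[of x] by (simp add: u_def)
    then show ?thesis
      by (simp only: amplification_def)
  qed
  ultimately show "((\<lambda>x. u x / avg u x) \<longlongrightarrow> gain) at_top"
    by (simp only:)
qed

lemma deficit_ratio_subsequence:
  assumes Q: "profile Q" and X: "filterlim X at_top sequentially"
  defines "u \<equiv> \<lambda>x. \<rho>p - Q x"
  obtains s U where "strict_mono (s :: nat \<Rightarrow> nat)" "decay_profile gain U"
    "\<And>y. (\<lambda>n. u (X (s n) + y) / u (X (s n))) \<longlonglongrightarrow> U y"
proof -
  have u: "continuous_on UNIV u" "antimono u" "0 < u x"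
    "((\<lambda>x. u x / avg u x) \<longlongrightarrow> gain) at_top" for x
    using deficit[OF Q] unfolding u_def by blast+
  have g: "0 < gain" "gain < 2 * gain"
    using gain_gt_1 by auto
  define f where "f n y = u (X n + y) / u (X n)" for n y
  have avg_f: "avg (f n) y = avg u (X n + y) / u (X n)" for n y
    using avg_cmult[of "1 / u (X n)" "\<lambda>y. u (X n + y)" y] unfolding f_def avg_shift by simp
  have avg_pos: "0 < avg u x" for x
    by (rule avg_pos[OF u(1) u(3)])
  have u_ne: "u x \<noteq> 0" for x
    using u(3)[of x] by simp
  have X_shift: "filterlim (\<lambda>n. X n + y) at_top sequentially" for y
    using filterlim_tendsto_add_at_top[OF tendsto_const X, of y] by (simp add: add.commute)
  show thesis
  \<comment> \<open>The ratio of deficit to average tends to \<open>gain\<close>, hence is below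
    \<open>2 * gain\<close> on each half line once \<open>X n\<close> is large.\<close>
  proof (rule decay_compactness[of f "2 * gain" gain])
    show "continuous_on UNIV (f n)" for n
      unfolding f_def using u_ne by (intro continuous_intros continuous_on_compose2[OF u(1)]) auto
    show "antimono (f n)" for n
      unfolding f_def using less_imp_le[OF u(3)]
      by (intro antimonoI divide_right_mono antimonoD[OF u(2)]) auto
    show "0 < f n y" for n y
      unfolding f_def by (intro divide_pos_pos u(3))
    show "f n 0 = 1" for n
      using u_ne by (simp add: f_def)
    show "0 < 2 * gain"
      using g by simp
    show "\<forall>\<^sub>F n in sequentially. \<forall>x\<ge>Y. f n x \<le> 2 * gain * avg (f n) x" for Y
    proof -
      have "\<forall>\<^sub>F x in at_top. u x / avg u x < 2 * gain"
        using u(4) g(2) by (rule order_tendstoD)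
      then obtain x1 where x1: "\<And>x. x \<ge> x1 \<Longrightarrow> u x / avg u x < 2 * gain"
        unfolding eventually_at_top_linorder by blast
      have "\<forall>\<^sub>F n in sequentially. x1 \<le> X n + Y"
        using X_shift[of Y] unfolding filterlim_at_top by blast
      then show ?thesis
      proof eventually_elim
        case (elim n)
        show ?case
        proof (intro allI impI)
          fix x assume "Y \<le> x"
          then have "u (X n + x) \<le> 2 * gain * avg u (X n + x)"
            using elim x1[of "X n + x"] avg_pos[of "X n + x"] by (simp add: divide_less_eq)
          from divide_right_mono[OF this less_imp_le[OF u(3)[of "X n"]]]
          show "f n x \<le> 2 * gain * avg (f n) x"
            by (simp add: avg_f f_def)
        qed
      qed
    qed
    show "(\<lambda>n. f n x / avg (f n) x) \<longlonglongrightarrow> gain" for x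
      using filterlim_compose[OF u(4) X_shift[of x]] u_ne by (simp add: avg_f f_def)
  qed (use that in \<open>simp add: f_def\<close>)
qed

text \<open>All subsequential limits are the unique decay profile, so the full limit exists and is
  the same for every profile \<open>Q\<close>. The role of \<open>Q0\<close> is to show that a decay
  profile exists.\<close>

lemma deficit_ratio_tendsto:
  assumes Q0: "profile Q0"
  obtains U where "decay_profile gain U"
    "\<And>Q y. profile Q \<Longrightarrow> ((\<lambda>x. (\<rho>p - Q (x + y)) / (\<rho>p - Q x)) \<longlongrightarrow> U y) at_top"
proof -
  obtain U where U: "decay_profile gain U"
    by (rule deficit_ratio_subsequence[OF Q0 filterlim_real_sequentially]) blast
  show thesis
  proof (rule that[OF U])
    fix Q y assume Q: "profile Q"
    show "((\<lambda>x. (\<rho>p - Q (x + y)) / (\<rho>p - Q x)) \<longlongrightarrow> U y) at_top"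
    proof (rule tendsto_at_topI_sequentially)
      fix X :: "nat \<Rightarrow> real" assume X: "filterlim X at_top sequentially"
      show "(\<lambda>n. (\<rho>p - Q (X n + y)) / (\<rho>p - Q (X n))) \<longlonglongrightarrow> U y"
      proof (rule subseq_principle)
        fix s :: "nat \<Rightarrow> nat" assume "strict_mono s"
        then have "filterlim (\<lambda>n. X (s n)) at_top sequentially"
          by (intro filterlim_compose[OF X] filterlim_subseq)
        then obtain t V where t: "strict_mono (t :: nat \<Rightarrow> nat)" and V: "decay_profile gain V"
          "\<And>y. (\<lambda>n. (\<rho>p - Q (X (s (t n)) + y)) / (\<rho>p - Q (X (s (t n))))) \<longlonglongrightarrow> V y"
          by (rule deficit_ratio_subsequence[OF Q]) blast
        moreover have "V = U"
          using decay_profile_unique[OF _ V(1) U] gain_gt_1 by simp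
        ultimately show "\<exists>t. strict_mono t \<and>
            (\<lambda>n. (\<rho>p - Q (X (s (t n)) + y)) / (\<rho>p - Q (X (s (t n))))) \<longlonglongrightarrow> U y"
          by blast
      qed
    qed
  qed
qed

text \<open>Two profiles aligned at a point far to the right have deficits with nearly the same ratios
  on a window of length \<open>h\<close>, so a small shift orders them on that window, and then to the left of
  it.\<close>

lemma profile_shifted_le:
  assumes Q: "profile Q" and R: "profile R" and \<delta>: "0 < \<delta>"
  obtains X where "\<And>x z y. X \<le> x \<Longrightarrow> X \<le> z \<Longrightarrow> Q x = R z \<Longrightarrow> y \<le> h \<Longrightarrow> Q (x + y) \<le> R (z + \<delta> + y)"
proof (rule deficit_ratio_tendsto[OF Q])
  fix U assume U: "decay_profile gain U"
    and lim: "\<And>Q y. profile Q \<Longrightarrow> ((\<lambda>x. (\<rho>p - Q (x + y)) / (\<rho>p - Q x)) \<longlongrightarrow> U y) at_top"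
  \<comment> \<open>The window is cut into cells of length \<open>d\<close>. Rounding a point to the
    end of its cell costs one \<open>d\<close> of the shift, and the other \<open>d\<close> leaves a
    strict gap.\<close>
  define d where "d = \<delta> / 2"
  have d: "0 < d" "\<delta> = 2 * d"
    using \<delta> by (auto simp: d_def)
  \<comment> \<open>A threshold strictly between the limit ratios at \<open>real j * d + d\<close>,
    the right end of cell \<open>j\<close>, and one \<open>d\<close> further; it separates the
    deficits of \<open>Q\<close> and of the shifted \<open>R\<close> on the whole cell.\<close>
  define m where "m j = (U (real j * d + d) + U (real j * d + 2 * d)) / 2" for j :: nat
  have m: "m j < U (real j * d + d)" "U (real j * d + 2 * d) < m j" for j
    using decay_profile_strict[OF gain_gt_1 U, of "real j * d + d" "real j * d + 2 * d"] d(1)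
    by (auto simp: m_def)
  define K where "K = nat \<lfloor>h / d\<rfloor>"
  have "\<forall>\<^sub>F x in at_top. \<forall>j\<in>{..K}. m j < (\<rho>p - Q (x + (real j * d + d))) / (\<rho>p - Q x)"
    by (intro eventually_ball_finite ballI order_tendstoD(1)[OF lim[OF Q] m(1)]) auto
  then obtain X1 where X1: "\<And>x j. X1 \<le> x \<Longrightarrow> j \<le> K \<Longrightarrow> m j < (\<rho>p - Q (x + (real j * d + d))) / (\<rho>p - Q x)"
    unfolding eventually_at_top_linorder by blast
  have "\<forall>\<^sub>F x in at_top. \<forall>j\<in>{..K}. (\<rho>p - R (x + (real j * d + 2 * d))) / (\<rho>p - R x) < m j"
    by (intro eventually_ball_finite ballI order_tendstoD(2)[OF lim[OF R] m(2)]) auto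
  then obtain X2 where X2: "\<And>x j. X2 \<le> x \<Longrightarrow> j \<le> K \<Longrightarrow> (\<rho>p - R (x + (real j * d + 2 * d))) / (\<rho>p - R x) < m j"
    unfolding eventually_at_top_linorder by blast
  note solQ = profile_solution(1)[OF Q] and solR = profile_solution(1)[OF R]
  show thesis
  proof (rule that[of "max X1 X2"])
    fix x z y assume xz: "max X1 X2 \<le> x" "max X1 X2 \<le> z" "Q x = R z" and y: "y \<le> h"
    show "Q (x + y) \<le> R (z + \<delta> + y)"
    proof (rule solution_le_backward[OF solution_shift[OF solQ, of x] solution_shift[OF solR, of "z + \<delta>"],
          where ?x0.0 = 0])
      fix y assume y: "y \<in> {0..0 + h}"
      define j where "j = nat \<lfloor>y / d\<rfloor>"
      have "j \<le> K"
        unfolding j_def K_def using y d(1) by (intro nat_mono floor_mono divide_right_mono) auto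
      have "real j = of_int \<lfloor>y / d\<rfloor>"
        using y d(1) by (simp add: j_def)
      then have "real j \<le> y / d" "y / d < real j + 1"
        by linarith+
      then have j: "real j * d \<le> y" "y < real j * d + d"
        using d(1) by (auto simp: field_simps)
      have "\<rho>p - R (z + \<delta> + y) \<le> \<rho>p - R (z + (real j * d + 2 * d))"
        using j d by (intro diff_left_mono monoD[OF solutionD(2)[OF solR]]) auto
      also have "\<dots> < m j * (\<rho>p - R z)"
        using X2[of z j] \<open>j \<le> K\<close> xz deficit(3)[OF R, of z] by (simp add: divide_less_eq)
      also have "\<dots> = m j * (\<rho>p - Q x)"
        by (simp add: xz(3))
      also have "\<dots> < \<rho>p - Q (x + (real j * d + d))"
        using X1[of x j] \<open>j \<le> K\<close> xz deficit(3)[OF Q, of x] by (simp add: less_divide_eq)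
      also have "\<dots> \<le> \<rho>p - Q (x + y)"
        using j by (intro diff_left_mono monoD[OF solutionD(2)[OF solQ]]) auto
      finally show "Q (x + y) \<le> R (z + \<delta> + y)"
        by simp
    qed (use y in auto)
  qed
qed

text \<open>The profiles are aligned far to the right by \<open>Q x = R z\<close>. One comparison,
  read at the origin where both equal \<rho>h, bounds the misalignment \<open>z - x\<close> by
  \<delta>; the opposite one then orders \<open>Q\<close> below \<open>R\<close> shifted by
  \<open>2 * \<delta>\<close>, and \<delta> tends to 0.\<close>

lemma profile_le:
  assumes Q: "profile Q" and R: "profile R"
  shows "Q y \<le> R y"
proof -
  note solQ = solutionD[OF profile_solution(1)[OF Q]] and solR = solutionD[OF profile_solution(1)[OF R]]
  have "Q y \<le> R (y + 2 * \<delta>)" if \<delta>: "0 < \<delta>" for \<delta>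
  proof -
    obtain X1 where X1: "\<And>x z y. X1 \<le> x \<Longrightarrow> X1 \<le> z \<Longrightarrow> Q x = R z \<Longrightarrow> y \<le> h \<Longrightarrow> Q (x + y) \<le> R (z + \<delta> + y)"
      by (rule profile_shifted_le[OF Q R \<delta>]) blast
    obtain X2 where X2: "\<And>x z y. X2 \<le> x \<Longrightarrow> X2 \<le> z \<Longrightarrow> R x = Q z \<Longrightarrow> y \<le> h \<Longrightarrow> R (x + y) \<le> Q (z + \<delta> + y)"
      by (rule profile_shifted_le[OF R Q \<delta>]) blast
    define X where "X = max X1 X2"
    have "R X < \<rho>p"
      using deficit(3)[OF R, of X] by simp
    then have "\<forall>\<^sub>F x in at_top. R X < Q x"
      using profile_solution(3)[OF Q] by (rule order_tendstoD[rotated])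
    then have "\<forall>\<^sub>F x in at_top. R X < Q x \<and> X \<le> x \<and> y \<le> x \<and> 0 \<le> x"
      by (intro eventually_conj eventually_ge_at_top)
    then obtain x where x: "R X < Q x" "X \<le> x" "y \<le> x" "0 \<le> x"
      by (metis (no_types, lifting) eventually_at_top_linorder order_refl)
    have "Q x < \<rho>p"
      using deficit(3)[OF Q, of x] by simp
    then have "\<forall>\<^sub>F z in at_top. Q x < R z"
      using profile_solution(3)[OF R] by (rule order_tendstoD[rotated])
    then have "\<forall>\<^sub>F z in at_top. Q x < R z \<and> X \<le> z"
      by (intro eventually_conj eventually_ge_at_top)
    then obtain z1 where z1: "Q x < R z1" "X \<le> z1"
      by (metis (no_types, lifting) eventually_at_top_linorder order_refl)
    obtain z where z: "X \<le> z" "R z = Q x"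
      using IVT'[of R X "Q x" z1] x z1 continuous_on_subset[OF solR(1)] by auto
    \<comment> \<open>This offset makes the argument of \<open>Q\<close> equal to 0.\<close>
    have "R (z + (- x - \<delta>)) \<le> Q (x + \<delta> + (- x - \<delta>))"
      using x z \<delta> h_pos by (intro X2) (auto simp: X_def)
    then have "R (z - x - \<delta>) \<le> R 0"
      using profile_solution(4)[OF Q] profile_solution(4)[OF R] by (simp add: algebra_simps)
    then have "z - x \<le> \<delta>"
      using profile_strict[OF R, of 0 "z - x - \<delta>"] by (cases "z - x - \<delta> > 0") auto
    have "Q (x + (y - x)) \<le> R (z + \<delta> + (y - x))"
      using x z h_pos by (intro X1) (auto simp: X_def)
    also have "\<dots> \<le> R (y + 2 * \<delta>)"
      using \<open>z - x \<le> \<delta>\<close> by (intro monoD[OF solR(2)]) auto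
    finally show ?thesis
      by simp
  qed
  then have ev: "\<forall>\<^sub>F \<delta> in at_right 0. Q y \<le> R (y + 2 * \<delta>)"
    by (auto simp: eventually_at_right_less eventually_at_filter)
  have "isCont R (y + 2 * 0)"
    using solR(1) by (simp add: continuous_on_eq_continuous_at)
  then have "((\<lambda>\<delta>. R (y + 2 * \<delta>)) \<longlongrightarrow> R (y + 2 * 0)) (at_right 0)"
    by (rule isCont_tendsto_compose) (intro tendsto_intros)
  from tendsto_lowerbound[OF this ev] show ?thesis
    by simp
qed

lemma profile_unique: "profile Q \<Longrightarrow> profile R \<Longrightarrow> Q = R"
  using profile_le by (intro ext antisym) blast+

end

section \<open>Convergence of the discrete profiles\<close>

locale discrete_profile = stationary_limits +
  fixes l :: real and P :: "real \<Rightarrow> real"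
  assumes l_pos: "0 < l" and discrete: "discrete_stationary_profile l w v P"
    and normalised: "normalised_between \<rho>m \<rho>p \<rho>h P"
begin

text \<open>As \<open>P\<close> is at least \<rho>m, this bounds the distance from any car to its
  leader; it tends to 0 with the car length.\<close>

definition reach :: real where "reach = l / \<rho>m"

lemma P_cont: "continuous_on UNIV P" and P_mono: "mono P"
  using discrete unfolding discrete_stationary_profile_def by auto

lemma P_low: "\<rho>m \<le> P x"
proof (rule tendsto_upperbound)
  show "(P \<longlongrightarrow> \<rho>m) at_bot"
    using normalised unfolding normalised_between_def by simp
qed (auto intro!: eventually_mono[OF eventually_le_at_bot[of x]] monoD[OF P_mono])

lemma P_lim: "(P \<longlongrightarrow> \<rho>p) at_top"
  using normalised unfolding normalised_between_def by simp

lemma P_high: "P x \<le> \<rho>p"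
  by (rule tendsto_lowerbound[OF P_lim])
    (auto intro!: eventually_mono[OF eventually_ge_at_top[of x]] monoD[OF P_mono])

lemma P_pos: "0 < P x"
  using P_low[of x] \<rho>m_pos by simp

lemma leader_ge: "x + l \<le> leader l P x"
proof -
  have "l / 1 \<le> l / P x"
    using P_pos[of x] P_high[of x] \<rho>p_less l_pos by (intro divide_left_mono) auto
  then show ?thesis
    by (simp add: leader_def)
qed

lemma leader_le: "leader l P x \<le> x + reach"
  unfolding leader_def reach_def
  using P_low[of x] \<rho>m_pos l_pos by (intro add_left_mono divide_left_mono) auto

lemma iterate_ge: "x + real k * l \<le> (leader l P ^^ k) x"
proof (induction k)
  case (Suc k)
  then show ?case
    using leader_ge[of "(leader l P ^^ k) x"] by (simp add: distrib_right)
qed simp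

lemma iterate_step: "(leader l P ^^ k) x \<le> (leader l P ^^ Suc k) x"
  "(leader l P ^^ Suc k) x \<le> (leader l P ^^ k) x + reach"
  using leader_ge[of "(leader l P ^^ k) x"] leader_le[of "(leader l P ^^ k) x"] l_pos by auto

lemma iterate_cont: "continuous_on UNIV (leader l P ^^ k)"
proof (induction k)
  case (Suc k)
  have "continuous_on UNIV (leader l P)"
    unfolding leader_def[abs_def] using P_pos by (intro continuous_intros P_cont) (auto simp: less_le)
  from continuous_on_compose2[OF this Suc] show ?case
    by (simp add: o_def)
qed (simp add: id_def)

definition gap :: "real \<Rightarrow> nat \<Rightarrow> real" where
  "gap x k = (leader l P ^^ k) x - x"

lemma gap:
  "gap x 0 = 0" "real k * l \<le> gap x k" "0 \<le> gap x k" "gap x k \<le> gap x (Suc k)"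
  "gap x (Suc k) \<le> gap x k + reach"
proof -
  show *: "gap x 0 = 0" "real k * l \<le> gap x k" "gap x k \<le> gap x (Suc k)"
    "gap x (Suc k) \<le> gap x k + reach"
    using iterate_ge[of x k] iterate_step[of k x] by (auto simp: gap_def)
  show "0 \<le> gap x k"
    using *(2) l_pos by (meson less_imp_le mult_nonneg_nonneg of_nat_0_le_iff order_trans)
qed

text \<open>The iterates advance by at least \<open>l\<close>, so from this index on they lie
  strictly more than \<open>h\<close> ahead, beyond the support of the weight.\<close>

definition cars :: nat where "cars = Suc (nat \<lfloor>h / l\<rfloor>)"

lemma cars: "h < real k * l" if "cars \<le> k"
proof -
  have "h / l < real cars"
    unfolding cars_def using h_pos l_pos by (simp add: less_Suc_eq_le) linarith
  also have "\<dots> \<le> real k"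
    using that by simp
  finally show ?thesis
    using l_pos by (simp add: divide_less_eq)
qed

abbreviation A :: "real \<Rightarrow> real" where "A \<equiv> discrete_average l w P"

lemma average_finite_sum:
  "A x = (\<Sum>k<cars. integral {gap x k..gap x (Suc k)} w * P (x + gap x k))"
proof -
  have shift: "integral {(leader l P ^^ k) x .. (leader l P ^^ Suc k) x} (\<lambda>y. w (y - x))
      = integral {gap x k..gap x (Suc k)} w" for k
    using integral_shift_real_ivl[of "gap x k" "- x" "gap x (Suc k)" w] by (simp add: gap_def)
  have zero: "integral {gap x k..gap x (Suc k)} w = 0" if "k \<notin> {..<cars}" for k
  proof -
    have "integral {gap x k..gap x (Suc k)} w = integral {gap x k..gap x (Suc k)} (\<lambda>_. 0)"
      by (rule integral_cong) (use cars[of k] gap(2)[of k x] that w_outside in auto)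
    then show ?thesis by simp
  qed
  show ?thesis
    unfolding discrete_average_def shift
    by (subst suminf_finite[of "{..<cars}"]) (use zero in \<open>auto simp: gap_def\<close>)
qed

lemma A_cont: "continuous_on UNIV A"
proof -
  \<comment> \<open>Written with \<open>mass\<close>, the moving end points of the integrals become
    arguments of a continuous function.\<close>
  have eq: "A x = (\<Sum>k<cars. (mass (gap x (Suc k)) - mass (gap x k)) * P ((leader l P ^^ k) x))" for x
    unfolding average_finite_sum mass_diff[OF gap(3,4)] by (simp add: gap_def)
  have "continuous_on UNIV (\<lambda>x. gap x k)" for k
    unfolding gap_def by (intro continuous_intros iterate_cont)
  then show ?thesis
    unfolding eq
    by (intro continuous_intros mass_continuous continuous_on_compose2[OF P_cont iterate_cont]) (auto simp: gap)
qed

text \<open>The discrete average takes the value of \<open>P\<close> at the left end of each cell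
  between consecutive cars. This is at most \<open>P\<close> on the cell, and at least
  \<open>P\<close> shifted back by \<open>reach\<close>, since no cell is longer.\<close>

lemma A_bounds: "avg P (x - reach) \<le> A x" "A x \<le> avg P x"
proof -
  note int = avg_integrable_mono[OF P_mono]
  have T: "h \<le> gap x cars"
    using cars[of cars] gap(2)[of cars x] by simp
  have partial: "integral {0..gap x n} (\<lambda>s. P (x - reach + s) * w s)
        \<le> (\<Sum>k<n. integral {gap x k..gap x (Suc k)} w * P (x + gap x k)) \<and>
      (\<Sum>k<n. integral {gap x k..gap x (Suc k)} w * P (x + gap x k))
        \<le> integral {0..gap x n} (\<lambda>s. P (x + s) * w s)" for n
  proof (induction n)
    case (Suc n)
    have cmult: "integral {gap x n..gap x (Suc n)} w * P (x + gap x n)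
        = integral {gap x n..gap x (Suc n)} (\<lambda>s. P (x + gap x n) * w s)"
      by simp
    have "integral {gap x n..gap x (Suc n)} (\<lambda>s. P (x - reach + s) * w s)
        \<le> integral {gap x n..gap x (Suc n)} w * P (x + gap x n)"
      unfolding cmult
      by (intro integral_le weighted_integrable[OF int] integrable_on_mult_right w_integrable
          mult_right_mono monoD[OF P_mono]) (use gap(2-5)[where x = x and k = n] w_nonneg in auto)
    moreover have "integral {gap x n..gap x (Suc n)} w * P (x + gap x n)
        \<le> integral {gap x n..gap x (Suc n)} (\<lambda>s. P (x + s) * w s)"
      unfolding cmult
      by (intro integral_le weighted_integrable[OF int] integrable_on_mult_right w_integrable
          mult_right_mono monoD[OF P_mono]) (use gap(2-5)[where x = x and k = n] w_nonneg in auto)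
    moreover have "integral {0..gap x (Suc n)} (\<lambda>s. P (t + s) * w s) =
        integral {0..gap x n} (\<lambda>s. P (t + s) * w s) +
        integral {gap x n..gap x (Suc n)} (\<lambda>s. P (t + s) * w s)" for t
      by (rule Henstock_Kurzweil_Integration.integral_combine[symmetric]) (use gap weighted_integrable[OF int] in auto)
    ultimately show ?case
      using Suc.IH by simp
  qed (simp add: gap)
  show "avg P (x - reach) \<le> A x" "A x \<le> avg P x"
    using partial[of cars] weighted_has_integral[OF int T, of x]
      weighted_has_integral[OF int T, of "x - reach"]
    by (auto simp: average_finite_sum integral_unique)
qed

lemma avg_P_bounds: "\<rho>m \<le> avg P x" "avg P x \<le> \<rho>p"
  using avg_bounds[OF avg_integrable_mono[OF P_mono]] P_low P_high by blast+

text \<open>The constant is the car length divided by the travel time to the leader, and the point \<open>z\<close>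
  comes from the mean value theorem for the primitive \<open>\<Theta>\<close> of \<open>1 / v (A x)\<close>.\<close>

lemma travel_time:
  obtains k where "\<And>x. \<exists>z. x < z \<and> z < x + reach \<and> P x * v (A z) = k"
proof -
  have A_range: "0 < A x" "A x < 1" for x
    using A_bounds[of x] avg_P_bounds[of "x - reach"] avg_P_bounds[of x] \<rho>m_pos \<rho>p_less by linarith+
  have vA: "0 < v (A x)" for x
    using A_range[of x] by (intro v_pos) auto
  have "isCont (\<lambda>x. 1 / v (A x)) x" for x
  proof -
    have "isCont A x"
      using A_cont by (simp add: continuous_on_eq_continuous_at)
    then show ?thesis
      using isCont_v[OF A_range[of x]] vA[of x]
      by (intro continuous_intros) (auto intro: isCont_o2)
  qed
  then obtain \<Theta> where "\<And>x. (\<Theta> has_vector_derivative 1 / v (A x)) (at x)"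
    using einterval_antiderivative[of "-\<infinity>" \<infinity> "\<lambda>x. 1 / v (A x)"] by auto
  then have \<Theta>: "(\<Theta> has_real_derivative 1 / v (A x)) (at x)" for x
    by (simp add: has_real_derivative_iff_has_vector_derivative)
  \<comment> \<open>The profile equation says precisely that the leader map has the ratio of the two
    velocities as its derivative; this cancels when the travel time is differentiated.\<close>
  have leader_deriv: "(leader l P has_real_derivative v (A (leader l P x)) / v (A x)) (at x)" for x
  proof -
    define p' where "p' = - ((P x)\<^sup>2 / (l * v (A x))) * (v (A (leader l P x)) - v (A x))"
    have "(P has_real_derivative p') (at x)"
      using discrete unfolding discrete_stationary_profile_def p'_def by blast
    then have "((\<lambda>x. x + l / P x) has_real_derivative 1 - l * p' / (P x)\<^sup>2) (at x)"
      using P_pos[of x] by (auto intro!: derivative_eq_intros simp: power2_eq_square)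
    moreover have "1 - l * p' / (P x)\<^sup>2 = v (A (leader l P x)) / v (A x)"
    proof -
      have "l * p' / (P x)\<^sup>2 = (v (A x) - v (A (leader l P x))) / v (A x)"
        using P_pos[of x] l_pos vA[of x] by (simp add: p'_def field_simps)
      then show ?thesis
        using vA[of x] by (simp add: field_simps)
    qed
    ultimately show ?thesis
      by (simp add: leader_def[abs_def])
  qed
  define T where "T = \<Theta> (leader l P 0) - \<Theta> 0"
  have "((\<lambda>x. \<Theta> (leader l P x) - \<Theta> x) has_real_derivative 0) (at x)" for x
  proof -
    have "((\<lambda>x. \<Theta> (leader l P x) - \<Theta> x) has_real_derivative
        1 / v (A (leader l P x)) * (v (A (leader l P x)) / v (A x)) - 1 / v (A x)) (at x)"
      by (intro DERIV_diff DERIV_chain2[OF \<Theta> leader_deriv] \<Theta>)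
    then show ?thesis
      using vA[of "leader l P x"] by simp
  qed
  then have T: "\<Theta> (leader l P x) - \<Theta> x = T" for x
    unfolding T_def using DERIV_isconst_all by blast
  show thesis
  proof (rule that[of "l / T"])
    fix x
    have "x < leader l P x"
      using leader_ge[of x] l_pos by simp
    from MVT2[OF this, of \<Theta> "\<lambda>x. 1 / v (A x)"] \<Theta> obtain z where z: "x < z" "z < leader l P x"
      "\<Theta> (leader l P x) - \<Theta> x = (leader l P x - x) * (1 / v (A z))"
      by blast
    have "T = l / (P x * v (A z))"
      using z(3) unfolding T by (simp add: leader_def)
    then have "P x * v (A z) = l / T"
      using l_pos by simp
    then show "\<exists>z. x < z \<and> z < x + reach \<and> P x * v (A z) = l / T"
      using z leader_le[of x] by (intro exI[of _ z]) auto
  qed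
qed

text \<open>The point \<open>z\<close> of \<open>travel_time\<close> is within \<open>reach\<close>
  of \<open>x\<close>, so \<open>A_bounds\<close> encloses \<open>A z\<close> between averages at
  \<open>x - reach\<close> and \<open>x + reach\<close>. Passing to plus infinity in the resulting
  inequalities identifies the constant \<open>k\<close> as \<open>c\<close>.\<close>

lemma P_bounds: "c / v (avg P (x - reach)) \<le> P x" "P x \<le> c / v (avg P (x + reach))"
proof (atomize (full), rule travel_time)
  fix k assume k: "\<And>x. \<exists>z. x < z \<and> z < x + reach \<and> P x * v (A z) = k"
  have vpos: "0 < v (avg P y)" for y
    using avg_P_bounds[of y] \<rho>m_pos \<rho>p_less by (intro v_pos) auto
  have le: "k \<le> P x * v (avg P (x - reach)) \<and> P x * v (avg P (x + reach)) \<le> k" for x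
  proof -
    obtain z where z: "x < z" "z < x + reach" "P x * v (A z) = k"
      using k by blast
    have "avg P (x - reach) \<le> avg P (z - reach)" "avg P z \<le> avg P (x + reach)"
      using z by (auto intro!: avg_le avg_integrable_mono P_mono monoD[OF P_mono])
    then have "avg P (x - reach) \<le> A z" "A z \<le> avg P (x + reach)"
      using A_bounds[of z] by linarith+
    then have "v (A z) \<le> v (avg P (x - reach))" "v (avg P (x + reach)) \<le> v (A z)"
      using avg_P_bounds[of "x - reach"] avg_P_bounds[of "x + reach"] \<rho>m_pos \<rho>p_less
      by (auto intro!: v_le)
    then show ?thesis
      using P_pos[of x] z(3) by (auto intro!: mult_left_mono)
  qed
  have lim: "((\<lambda>x. P x * v (avg P (x + t))) \<longlongrightarrow> c) at_top" for t
  proof -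
    have "filterlim (\<lambda>x. x + t) at_top at_top"
      using filterlim_tendsto_add_at_top[OF tendsto_const[of t] filterlim_ident]
      by (simp add: add.commute)
    from filterlim_compose[OF mono_avg_tendsto_at_top[OF P_mono P_lim] this]
    have "((\<lambda>x. avg P (x + t)) \<longlongrightarrow> \<rho>p) at_top" .
    moreover have "isCont v \<rho>p"
      using isCont_v \<rho>m_pos \<rho>m_less less_\<rho>p \<rho>p_less by simp
    ultimately have "((\<lambda>x. P x * v (avg P (x + t))) \<longlongrightarrow> \<rho>p * v \<rho>p) at_top"
      by (intro tendsto_mult P_lim isCont_tendsto_compose[of _ v])
    then show ?thesis
      by (simp add: flux_def)
  qed
  have "k \<le> c"
    using le by (intro tendsto_lowerbound[OF lim[of "- reach"]]) auto
  moreover have "c \<le> k"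
    using le by (intro tendsto_upperbound[OF lim[of reach]]) auto
  ultimately show "c / v (avg P (x - reach)) \<le> P x \<and> P x \<le> c / v (avg P (x + reach))"
    using le[of x] vpos by (simp add: divide_le_eq le_divide_eq)
qed

end

section \<open>Limits of the discrete profiles\<close>

context stationary_limits
begin

text \<open>Monotonicity provides limits at both ends, and the equation gives them the flux
  \<open>c\<close>. The value \<rho>h at 0 places them on opposite sides of the stagnation point,
  where the flux determines them.\<close>

lemma solution_profile:
  assumes Q: "solution Q" and "Q 0 = \<rho>h"
  shows "profile Q"
proof -
  note Q' = solutionD[OF Q]
  have vpos: "0 < v (avg Q x)" for x
    using Q'(7,8)[of x] \<rho>m_pos \<rho>p_less by (intro v_pos) auto
  have eq: "Q x * v (avg Q x) = c" for x
    unfolding Q'(5)[of x] using vpos[of x] by simp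
  have limit_flux: "flux v q = c"
    if "(Q \<longlongrightarrow> q) F" "(avg Q \<longlongrightarrow> q) F" "F \<noteq> bot" "\<rho>m \<le> q" "q \<le> \<rho>p" for q and F :: "real filter"
  proof -
    have "isCont v q"
      using isCont_v that \<rho>m_pos \<rho>p_less by simp
    then have "((\<lambda>x. Q x * v (avg Q x)) \<longlongrightarrow> q * v q) F"
      using that by (intro tendsto_mult isCont_tendsto_compose[of _ v])
    then show ?thesis
      unfolding eq flux_def[of v q] using that(3) by (simp add: tendsto_const_iff)
  qed
  have "incseq (\<lambda>n. Q (real n))"
    by (intro monoI monoD[OF Q'(2)]) auto
  then obtain q where "(\<lambda>n. Q (real n)) \<longlonglongrightarrow> q"
    using incseq_convergent Q'(4) by blast
  then have q: "(Q \<longlongrightarrow> q) at_top"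
    by (intro tendsto_at_topI_sequentially_real Q'(2))
  have "\<rho>h \<le> q"
    by (rule tendsto_lowerbound[OF q])
      (use monoD[OF Q'(2), of 0] assms(2) in \<open>auto intro!: eventually_mono[OF eventually_ge_at_top[of 0]]\<close>)
  moreover have "q \<le> \<rho>p"
    by (rule tendsto_upperbound[OF q]) (auto simp: Q'(4))
  ultimately have "q = \<rho>p"
    using \<rho>m_less by (intro flux_right_unique limit_flux[OF q mono_avg_tendsto_at_top[OF Q'(2) q]]) auto
  have "decseq (\<lambda>n. Q (- real n))"
    by (intro antimonoI monoD[OF Q'(2)]) auto
  then obtain r where "(\<lambda>n. Q (- real n)) \<longlonglongrightarrow> r"
    using decseq_convergent Q'(3) by blast
  then have "(\<lambda>n. - Q (- real n)) \<longlonglongrightarrow> - r"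
    by (rule tendsto_minus)
  \<comment> \<open>The passage from sequential to full limits is for increasing functions at plus
    infinity, hence the double reflection.\<close>
  then have "((\<lambda>x. - Q (- x)) \<longlongrightarrow> - r) at_top"
    by (intro tendsto_at_topI_sequentially_real monoI le_imp_neg_le monoD[OF Q'(2)]) auto
  then have r: "(Q \<longlongrightarrow> r) at_bot"
    unfolding filterlim_at_bot_mirror by (simp add: tendsto_minus_cancel_left)
  have "filterlim (\<lambda>x. x + h) at_bot at_bot"
    unfolding filterlim_at_bot
    by (metis (no_types, lifting) eventually_at_bot_linorder le_diff_eq)
  from filterlim_compose[OF r this] have "((\<lambda>x. Q (x + h)) \<longlongrightarrow> r) at_bot" .
  from tendsto_sandwich[OF _ _ r this] have "(avg Q \<longlongrightarrow> r) at_bot"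
    by (simp add: mono_avg_squeeze[OF Q'(2)])
  note r' = limit_flux[OF r this]
  have "r \<le> \<rho>h"
    by (rule tendsto_upperbound[OF r])
      (use monoD[OF Q'(2), of _ 0] assms(2) in \<open>auto intro!: eventually_mono[OF eventually_le_at_bot[of 0]]\<close>)
  moreover have "\<rho>m \<le> r"
    by (rule tendsto_lowerbound[OF r]) (auto simp: Q'(3))
  ultimately have "r = \<rho>m"
    using less_\<rho>p by (intro flux_left_unique r') auto
  have "0 < Q x \<and> Q x < 1" for x
    using Q'(3,4)[of x] \<rho>m_pos \<rho>p_less by linarith
  then show ?thesis
    unfolding profile_def stationary_profile_def normalised_between_def avg_def[symmetric]
    using Q'(1,2) eq q r \<open>q = \<rho>p\<close> \<open>r = \<rho>m\<close> assms(2) by blast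
qed

lemma c_div_v_mono:
  assumes "\<rho>m \<le> a" "a \<le> b" "b \<le> \<rho>p"
  shows "c / v a \<le> c / v b"
  using assms v_le[of a b] v_pos[of a] v_pos[of b] c_pos \<rho>m_pos \<rho>p_less
  by (intro divide_left_mono) auto

lemma discrete_subsequence_limit:
  assumes l: "\<And>n. 0 < l n" "l \<longlonglongrightarrow> 0"
    and P: "\<And>n. discrete_stationary_profile (l n) w v (P n)"
    and norm: "\<And>n. normalised_between \<rho>m \<rho>p \<rho>h (P n)"
  obtains s Q where "strict_mono (s :: nat \<Rightarrow> nat)" "profile Q" "\<And>x. (\<lambda>n. P (s n) x) \<longlonglongrightarrow> Q x"
proof -
  have D: "discrete_profile h w v \<rho>h \<rho>m \<rho>p (l n) (P n)" for n
    by unfold_locales (rule l P norm)+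
  note cont = discrete_profile.P_cont[OF D] and mono = discrete_profile.P_mono[OF D]
    and low = discrete_profile.P_low[OF D] and high = discrete_profile.P_high[OF D]
    and bounds = discrete_profile.P_bounds[OF D, unfolded discrete_profile.reach_def[OF D]]
  have abs: "\<bar>P n x\<bar> \<le> \<rho>p" for n x
    using low[of n x] high[of n x] \<rho>m_pos by simp
  have "Bseq (\<lambda>n. P n x)" for x
    by (rule BseqI'[of _ \<rho>p]) (simp add: abs)
  then obtain s F E where s: "strict_mono (s :: nat \<Rightarrow> nat)" and F: "mono F" "countable E"
    "\<And>x. x \<notin> E \<Longrightarrow> (\<lambda>n. P (s n) x) \<longlonglongrightarrow> F x"
    by (rule helly_pointwise_bounded[of P, OF cont mono]) blast
  have int: "avg_integrable (P n)" for n
    by (rule avg_integrable_mono[OF mono])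
  have bdd: "\<forall>\<^sub>F n in sequentially. \<forall>t\<in>{0..h}. \<bar>P (s n) (x + t)\<bar> \<le> \<rho>p" for x
    using abs by (intro always_eventually allI ballI)
  have lim_avg: "(\<lambda>n. avg (P (s n)) x) \<longlonglongrightarrow> avg F x" for x
    by (rule avg_tendsto(2)[OF int F(2,3) bdd])
  have avg_P: "\<rho>m \<le> avg (P n) x" "avg (P n) x \<le> \<rho>p" for n x
    using avg_bounds[OF int] low high by blast+
  have avg_F: "\<rho>m \<le> avg F x" "avg F x \<le> \<rho>p" for x
    using LIMSEQ_le_const[OF lim_avg] LIMSEQ_le_const2[OF lim_avg] avg_P by blast+
  \<comment> \<open>The Helly limit \<open>F\<close> is known off a countable set and may jump;
    applying the equation to its average gives a continuous candidate defined everywhere.\<close>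
  define Q where "Q x = c / v (avg F x)" for x
  have vcont: "isCont v (avg F x)" and vpos: "0 < v (avg F x)" for x
    using avg_F[of x] \<rho>m_pos \<rho>p_less by (auto intro!: isCont_v v_pos)
  have Q_lim: "(\<lambda>n. c / v (avg (P (s n)) x)) \<longlonglongrightarrow> Q x" for x
    unfolding Q_def using vpos[of x]
    by (intro tendsto_divide tendsto_const isCont_tendsto_compose[OF vcont lim_avg]) simp
  have "isCont Q x" for x
  proof -
    have "isCont (avg F) x"
      using avg_continuous[OF F(1)] by (simp add: continuous_on_eq_continuous_at)
    then show ?thesis
      unfolding Q_def[abs_def] using vpos[of x]
      by (intro continuous_intros isCont_o2[where f = "avg F" and g = v] vcont) auto
  qed
  then have Q_cont: "continuous_on UNIV Q" and Q_isCont: "\<And>x. isCont Q x"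
    by (auto simp: continuous_on_eq_continuous_at)
  \<comment> \<open>Monotonicity replaces the bound's moving offset by a fixed \<delta>, so that the
    index can tend to infinity at fixed points before \<delta> tends to 0.\<close>
  have near: "c / v (avg (P n) (x - \<delta>)) \<le> P n x \<and> P n x \<le> c / v (avg (P n) (x + \<delta>))"
    if "l n / \<rho>m \<le> \<delta>" for n x \<delta>
  proof -
    have "avg (P n) (x - \<delta>) \<le> avg (P n) (x - l n / \<rho>m)" "avg (P n) (x + l n / \<rho>m) \<le> avg (P n) (x + \<delta>)"
      using that by (auto intro!: avg_le int monoD[OF mono])
    then have "c / v (avg (P n) (x - \<delta>)) \<le> c / v (avg (P n) (x - l n / \<rho>m))"
      "c / v (avg (P n) (x + l n / \<rho>m)) \<le> c / v (avg (P n) (x + \<delta>))"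
      by (auto intro!: c_div_v_mono avg_P)
    then show ?thesis
      using bounds[of n x] by linarith
  qed
  have "(\<lambda>n. l (s n) / \<rho>m) \<longlonglongrightarrow> 0 / \<rho>m"
    using \<rho>m_pos by (intro tendsto_divide LIMSEQ_subseq_LIMSEQ[OF l(2) s, unfolded o_def] tendsto_const) auto
  then have small: "\<forall>\<^sub>F n in sequentially. l (s n) / \<rho>m < \<delta>" if "0 < \<delta>" for \<delta>
    using that by (intro order_tendstoD(2)) auto
  have lim: "(\<lambda>n. P (s n) x) \<longlonglongrightarrow> Q x" for x
  proof (rule order_tendstoI)
    have right: "((\<lambda>\<delta>. Q (x + \<sigma> * \<delta>)) \<longlongrightarrow> Q x) (at_right 0)" for \<sigma>
      by (rule isCont_tendsto_compose[OF Q_isCont]) (auto intro!: tendsto_eq_intros)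
    fix a
    {
      assume "a < Q x"
      from order_tendstoD(1)[OF right[of "-1"] this]
      have "\<forall>\<^sub>F \<delta> in at_right 0. 0 < \<delta> \<and> a < Q (x - \<delta>)"
        by (intro eventually_conj eventually_at_right_less) simp
      then obtain \<delta> where \<delta>: "0 < \<delta>" "a < Q (x - \<delta>)"
        using eventually_happens'[OF trivial_limit_at_right_real] by blast
      from small[OF \<delta>(1)] order_tendstoD(1)[OF Q_lim \<delta>(2)]
      show "\<forall>\<^sub>F n in sequentially. a < P (s n) x"
      proof eventually_elim
        case (elim n)
        then show ?case using near[of "s n" \<delta> x] by linarith
      qed
    }
    {
      assume "Q x < a"
      from order_tendstoD(2)[OF right[of 1] this]
      have "\<forall>\<^sub>F \<delta> in at_right 0. 0 < \<delta> \<and> Q (x + \<delta>) < a"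
        by (intro eventually_conj eventually_at_right_less) simp
      then obtain \<delta> where \<delta>: "0 < \<delta>" "Q (x + \<delta>) < a"
        using eventually_happens'[OF trivial_limit_at_right_real] by blast
      from small[OF \<delta>(1)] order_tendstoD(2)[OF Q_lim \<delta>(2)]
      show "\<forall>\<^sub>F n in sequentially. P (s n) x < a"
      proof eventually_elim
        case (elim n)
        then show ?case using near[of "s n" \<delta> x] by linarith
      qed
    }
  qed
  have "(\<lambda>n. avg (P (s n)) x) \<longlonglongrightarrow> avg Q x" for x
    by (rule avg_tendsto(2)[OF int countable_empty lim bdd])
  then have "avg Q x = avg F x" for x
    using LIMSEQ_unique lim_avg by blast
  then have "solution Q"
    unfolding solution_def
    using Q_cont LIMSEQ_le_const[OF lim] LIMSEQ_le_const2[OF lim] low high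
    by (auto simp: Q_def[symmetric] intro!: monoI LIMSEQ_le[OF lim lim] monoD[OF mono])
  moreover have "Q 0 = \<rho>h"
    using lim[of 0] norm by (simp add: normalised_between_def LIMSEQ_const_iff)
  ultimately show thesis
    using that[OF s solution_profile lim] by blast
qed

end

theorem theorem4p1:
  fixes h \<rho>h \<rho>m \<rho>p :: real
    and w v :: "real \<Rightarrow> real"
    and l :: "nat \<Rightarrow> real"
    and P :: "nat \<Rightarrow> real \<Rightarrow> real"
  assumes "h > 0"
    and "weight_function h w"
    and "velocity_function v"
    and "stagnation_point v \<rho>h"
    and "0 < \<rho>m" and "\<rho>m < \<rho>h" and "\<rho>h < \<rho>p" and "\<rho>p < 1"
    and "flux v \<rho>m = flux v \<rho>p"
    and "\<And>n. l n > 0"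
    and "l \<longlonglongrightarrow> 0"
    and "\<And>n. discrete_stationary_profile (l n) w v (P n)"
    and "\<And>n. normalised_between \<rho>m \<rho>p \<rho>h (P n)"
  shows "\<exists>Q. (\<forall>x. (\<lambda>n. P n x) \<longlonglongrightarrow> Q x) \<and>
             stationary_profile h w v Q \<and> normalised_between \<rho>m \<rho>p \<rho>h Q \<and>
             (\<forall>R. stationary_profile h w v R \<and> normalised_between \<rho>m \<rho>p \<rho>h R \<longrightarrow> R = Q)"
proof -
  interpret stationary_limits h w v \<rho>h \<rho>m \<rho>p
    by unfold_locales (rule assms)+
  have sub: "\<exists>t Q. strict_mono t \<and> profile Q \<and> (\<forall>x. (\<lambda>n. P (s (t n)) x) \<longlonglongrightarrow> Q x)"
    if s: "strict_mono s" for s :: "nat \<Rightarrow> nat"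
  proof -
    have "(\<lambda>n. l (s n)) \<longlonglongrightarrow> 0"
      using LIMSEQ_subseq_LIMSEQ[OF assms(11) s] by (simp add: o_def)
    then obtain t Q where "strict_mono (t :: nat \<Rightarrow> nat)" "profile Q"
      "\<And>x. (\<lambda>n. P (s (t n)) x) \<longlonglongrightarrow> Q x"
      by (rule discrete_subsequence_limit[of "\<lambda>n. l (s n)" "\<lambda>n. P (s n)", OF assms(10) _ assms(12,13)]) blast
    then show ?thesis by blast
  qed
  obtain Q where Q: "profile Q"
    using sub[OF strict_mono_id] by blast
  \<comment> \<open>Every subsequence has a further one converging to some profile, and by
    uniqueness this profile is \<open>Q\<close>.\<close>
  have "(\<lambda>n. P n x) \<longlonglongrightarrow> Q x" for x
    by (rule subseq_principle) (use sub profile_unique[OF Q] in metis)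
  then show ?thesis
    using Q profile_unique[OF _ Q] unfolding profile_def by blast
qed

end
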